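(* Let $G$ be a 2-connected $\{K_{1,3},S\}$-$o$-heavy graph, where $S\in\{P_4,P_5,C_3,Z_1,Z_2,B,N\}$. Then $cl_c(G)$ is claw-free and $N$-$p$-heavy.
   Context: All graphs are finite, simple and undirected; $n=|V(G)|$ and $d(v)$ denotes the degree of $v$ in $G$. A pair of nonadjacent vertices $\{u,v\}$ is an $o$-heavy pair if $d(u)+d(v)\ge n$; an adjacent pair $\{u,v\}$ with $d(u)+d(v)\ge n$ is an $a$-heavy pair; a vertex $u$ is heavy if $d(u)\ge n/2$. For a graph $H$, $G$ is $H$-$o$-heavy if every induced subgraph of $G$ isomorphic to $H$ contains an $o$-heavy pair of $G$; for a family $\mathcal H$, $G$ is $\mathcal H$-$o$-heavy if it is $H$-$o$-heavy for every $H\in\mathcal H$. $K_{1,3}$ is the claw; $P_k$ and $C_k$ are the path and cycle on $k$ vertices; $Z_k$ is obtained by identifying a vertex of a $C_3$ with an end-vertex of a $P_{k+1}$; $B$ (bull) is a triangle with a pendant edge attached at two of its vertices; $N$ (net) is a triangle $a_1a_2a_3$ with pendant vertices $b_1,b_2,b_3$, where $b_i$ is adjacent only to $a_i$. An induced net of $G$ is $p$-heavy if its triangle $a_1a_2a_3$ contains an $a$-heavy pair of $G$; $G$ is $N$-$p$-heavy if every induced net of $G$ is $p$-heavy. $cl_c(G)$ is Čada's closure of a claw-$o$-heavy graph $G$: for $x\in V(G)$, let $G^{BC}_x$ be $G$ plus all edges $uv$ with $u,v\in N(x)$, $uv\notin E(G)$, $d(u)+d(v)\ge n$. A vertex $x$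 is $c$-eligible if $N(x)$ is not a clique in $G^{BC}_x$ and either (i) $G^{BC}_x[N(x)]$ is connected, or (ii) $G^{BC}_x[N(x)]$ is the disjoint union of two cliques $C_1,C_2$ and $x$ lies in an $o$-heavy pair $\{x,z\}$ of $G$ with $zy_1,zy_2\in E(G)$ for some $y_1\in C_1$, $y_2\in C_2$. The local completion at a $c$-eligible $x$ adds all edges between vertices of $N(x)$; $cl_c(G)$ is obtained by repeating local completions at $c$-eligible vertices until none remain (it is uniquely determined, and equals the minimum $\{K_{1,3},\text{diamond}\}$-free spanning supergraph of $G$ with no $o$-heavy pair).
   Formalization: In the definition of a c-eligible vertex x, "N(x) is not a clique" is taken in G itself, not in G^{BC}_x; with the latter wording K_{3,3} would be its own closure and the claim would fail. The result is stated for every terminal graph of the local completions. *)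

theory Defs
  imports Main
begin

record 'a ugraph =
  verts :: "'a set"
  edges :: "'a set set"

definition simple_graph :: "'a ugraph \<Rightarrow> bool" where
  "simple_graph G \<longleftrightarrow>
     finite (verts G) \<and> (\<forall>e\<in>edges G. e \<subseteq> verts G \<and> card e = 2)"

definition adj :: "'a ugraph \<Rightarrow> 'a \<Rightarrow> 'a \<Rightarrow> bool" where
  "adj G u v \<longleftrightarrow> {u, v} \<in> edges G"

definition nbhd :: "'a ugraph \<Rightarrow> 'a \<Rightarrow> 'a set" where
  "nbhd G x = {y. adj G x y}"

definition deg :: "'a ugraph \<Rightarrow> 'a \<Rightarrow> nat" where
  "deg G x = card (nbhd G x)"

definition induced_subgraph :: "'a ugraph \<Rightarrow> 'a set \<Rightarrow> 'a ugraph" where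
  "induced_subgraph G A = \<lparr>verts = A, edges = {e \<in> edges G. e \<subseteq> A}\<rparr>"

definition graph_iso :: "('a \<Rightarrow> 'b) \<Rightarrow> 'a ugraph \<Rightarrow> 'b ugraph \<Rightarrow> bool" where
  "graph_iso f G H \<longleftrightarrow>
     bij_betw f (verts G) (verts H) \<and>
     (\<forall>u\<in>verts G. \<forall>v\<in>verts G. adj G u v \<longleftrightarrow> adj H (f u) (f v))"

definition isomorphic :: "'a ugraph \<Rightarrow> 'b ugraph \<Rightarrow> bool" where
  "isomorphic G H \<longleftrightarrow> (\<exists>f. graph_iso f G H)"

definition connected_graph :: "'a ugraph \<Rightarrow> bool" where
  "connected_graph G \<longleftrightarrow>
     verts G \<noteq> {} \<and> (\<forall>u\<in>verts G. \<forall>v\<in>verts G. (adj G)\<^sup>*\<^sup>* u v)"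

definition two_connected :: "'a ugraph \<Rightarrow> bool" where
  "two_connected G \<longleftrightarrow>
     card (verts G) \<ge> 3 \<and> connected_graph G \<and>
     (\<forall>v\<in>verts G. connected_graph (induced_subgraph G (verts G - {v})))"

definition is_clique :: "'a ugraph \<Rightarrow> 'a set \<Rightarrow> bool" where
  "is_clique G A \<longleftrightarrow> (\<forall>u\<in>A. \<forall>v\<in>A. u \<noteq> v \<longrightarrow> adj G u v)"

definition path_graph :: "nat \<Rightarrow> nat ugraph" where
  "path_graph k = \<lparr>verts = {..<k}, edges = {{i, Suc i} |i. Suc i < k}\<rparr>"

text \<open>Only meaningful for \<open>k \<ge> 3\<close>.\<close>
definition cycle_graph :: "nat \<Rightarrow> nat ugraph" where
  "cycle_graph k = \<lparr>verts = {..<k}, edges = {{i, Suc i mod k} |i. i < k}\<rparr>"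

text \<open>The triangle is on 0, 1, 2; the path with \<open>k + 1\<close> vertices is 2, 3, ..., \<open>k + 2\<close>.\<close>
definition Z_graph :: "nat \<Rightarrow> nat ugraph" where
  "Z_graph k = \<lparr>verts = {..<k + 3},
     edges = {{0, 1}, {1, 2}, {0, 2}} \<union> {{i, Suc i} |i. 2 \<le> i \<and> i < k + 2}\<rparr>"

definition claw :: "nat ugraph" where
  "claw = \<lparr>verts = {0, 1, 2, 3}, edges = {{0, 1}, {0, 2}, {0, 3}}\<rparr>"

definition bull :: "nat ugraph" where
  "bull = \<lparr>verts = {0, 1, 2, 3, 4},
     edges = {{0, 1}, {1, 2}, {0, 2}, {0, 3}, {1, 4}}\<rparr>"

text \<open>The triangle is 0, 1, 2, and vertex \<open>i + 3\<close> is the pendant neighbour of \<open>i\<close>.\<close>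
definition net :: "nat ugraph" where
  "net = \<lparr>verts = {0, 1, 2, 3, 4, 5},
     edges = {{0, 1}, {1, 2}, {0, 2}, {0, 3}, {1, 4}, {2, 5}}\<rparr>"

definition o_heavy_pair :: "'a ugraph \<Rightarrow> 'a \<Rightarrow> 'a \<Rightarrow> bool" where
  "o_heavy_pair G u v \<longleftrightarrow>
     u \<in> verts G \<and> v \<in> verts G \<and> u \<noteq> v \<and> \<not> adj G u v \<and>
     deg G u + deg G v \<ge> card (verts G)"

definition a_heavy_pair :: "'a ugraph \<Rightarrow> 'a \<Rightarrow> 'a \<Rightarrow> bool" where
  "a_heavy_pair G u v \<longleftrightarrow> adj G u v \<and> deg G u + deg G v \<ge> card (verts G)"

definition o_heavy :: "'b ugraph \<Rightarrow> 'a ugraph \<Rightarrow> bool" where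
  "o_heavy H G \<longleftrightarrow>
     (\<forall>A\<subseteq>verts G. isomorphic H (induced_subgraph G A) \<longrightarrow>
        (\<exists>u\<in>A. \<exists>v\<in>A. o_heavy_pair G u v))"

definition family_o_heavy :: "'b ugraph set \<Rightarrow> 'a ugraph \<Rightarrow> bool" where
  "family_o_heavy \<H> G \<longleftrightarrow> (\<forall>H\<in>\<H>. o_heavy H G)"

definition claw_free :: "'a ugraph \<Rightarrow> bool" where
  "claw_free G \<longleftrightarrow> (\<forall>A\<subseteq>verts G. \<not> isomorphic claw (induced_subgraph G A))"

definition N_p_heavy :: "'a ugraph \<Rightarrow> bool" where
  "N_p_heavy G \<longleftrightarrow>
     (\<forall>A\<subseteq>verts G. \<forall>f. graph_iso f net (induced_subgraph G A) \<longrightarrow>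
        (\<exists>i\<in>{0, 1, 2}. \<exists>j\<in>{0, 1, 2}. a_heavy_pair G (f i) (f j)))"

definition BC_graph :: "'a ugraph \<Rightarrow> 'a \<Rightarrow> 'a ugraph" where
  "BC_graph G x = G\<lparr>edges := edges G \<union>
     {{u, v} |u v. u \<in> nbhd G x \<and> v \<in> nbhd G x \<and> u \<noteq> v \<and> \<not> adj G u v \<and>
                   deg G u + deg G v \<ge> card (verts G)}\<rparr>"

text \<open>
  The requirement that \<open>nbhd G x\<close> is not a clique refers to \<open>G\<close> itself (Cada's
  definition), not to \<open>BC_graph G x\<close>.  With the latter no vertex of \<open>K\<^bsub>3,3\<^esub>\<close> would be
  eligible, so \<open>K\<^bsub>3,3\<^esub>\<close> would be its own closure although it contains claws and
  o-heavy pairs.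
\<close>
definition c_eligible :: "'a ugraph \<Rightarrow> 'a \<Rightarrow> bool" where
  "c_eligible G x \<longleftrightarrow>
     x \<in> verts G \<and> \<not> is_clique G (nbhd G x) \<and>
     (connected_graph (induced_subgraph (BC_graph G x) (nbhd G x)) \<or>
      (\<exists>C\<^sub>1 C\<^sub>2 z.
         C\<^sub>1 \<union> C\<^sub>2 = nbhd G x \<and> C\<^sub>1 \<inter> C\<^sub>2 = {} \<and>
         is_clique (BC_graph G x) C\<^sub>1 \<and> is_clique (BC_graph G x) C\<^sub>2 \<and>
         (\<forall>u\<in>C\<^sub>1. \<forall>v\<in>C\<^sub>2. \<not> adj (BC_graph G x) u v) \<and>
         o_heavy_pair G x z \<and> (\<exists>y\<^sub>1\<in>C\<^sub>1. adj G z y\<^sub>1) \<and> (\<exists>y\<^sub>2\<in>C\<^sub>2. adj G z y\<^sub>2)))"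

definition local_completion :: "'a ugraph \<Rightarrow> 'a \<Rightarrow> 'a ugraph" where
  "local_completion G x = G\<lparr>edges := edges G \<union>
     {{u, v} |u v. u \<in> nbhd G x \<and> v \<in> nbhd G x \<and> u \<noteq> v}\<rparr>"

definition closure_step :: "'a ugraph \<Rightarrow> 'a ugraph \<Rightarrow> bool" where
  "closure_step G G' \<longleftrightarrow> (\<exists>x. c_eligible G x \<and> G' = local_completion G x)"

text \<open>
  \<open>is_cl_c G H\<close>: the graph \<open>H\<close> is a result of performing local completions at
  c-eligible vertices, starting from \<open>G\<close>, until none remain (degrees and eligibility are
  taken in the current graph).
\<close>
definition is_cl_c :: "'a ugraph \<Rightarrow> 'a ugraph \<Rightarrow> bool" where
  "is_cl_c G H \<longleftrightarrow> closure_step\<^sup>*\<^sup>* G H \<and> (\<forall>x\<in>verts H. \<not> c_eligible H x)"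

lemma simple_graph_local_completion:
  assumes "simple_graph G"
  shows "simple_graph (local_completion G x)"
proof -
  have "nbhd G x \<subseteq> verts G"
    using assms by (auto simp: simple_graph_def nbhd_def adj_def)
  then show ?thesis
    using assms by (auto simp: simple_graph_def local_completion_def)
qed

lemma ex_is_cl_c:
  assumes "simple_graph G"
  shows "\<exists>H. is_cl_c G H"
  using assms
proof (induction "card (Pow (verts G) - edges G)" arbitrary: G rule: less_induct)
  case less
  show ?case
  proof (cases "\<exists>x\<in>verts G. c_eligible G x")
    case False
    then show ?thesis by (auto simp: is_cl_c_def)
  next
    case True
    then obtain x where x: "c_eligible G x" by blast
    let ?G = "local_completion G x"
    obtain u v where uv: "u \<in> nbhd G x" "v \<in> nbhd G x" "u \<noteq> v" "{u, v} \<notin> edges G"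
      using x unfolding c_eligible_def is_clique_def adj_def by blast
    have sub: "nbhd G x \<subseteq> verts G"
      using less.prems by (auto simp: simple_graph_def nbhd_def adj_def)
    have "Pow (verts ?G) - edges ?G \<subseteq> Pow (verts G) - edges G"
      by (auto simp: local_completion_def)
    moreover have "{u, v} \<in> Pow (verts G) - edges G"
      using uv sub by auto
    moreover have "{u, v} \<notin> Pow (verts ?G) - edges ?G"
      using uv by (auto simp: local_completion_def)
    ultimately have "Pow (verts ?G) - edges ?G \<subset> Pow (verts G) - edges G"
      by (metis psubsetI)
    then have "card (Pow (verts ?G) - edges ?G) < card (Pow (verts G) - edges G)"
      using less.prems by (intro psubset_card_mono) (auto simp: simple_graph_def)
    then obtain H where "is_cl_c ?G H"
      using less.hyps simple_graph_local_completion[OF less.prems] by blast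
    moreover have "closure_step G ?G"
      using x by (auto simp: closure_step_def)
    ultimately have "is_cl_c G H"
      unfolding is_cl_c_def by (blast intro: converse_rtranclp_into_rtranclp)
    then show ?thesis ..
  qed
qed

end

theory Submission
  imports Defs
begin

text \<open>
  The closure \<open>H\<close> has no o-heavy pair and is claw-free and diamond-free, so its maximal cliques meet
  in at most one vertex; and any two \<open>H\<close>-adjacent vertices are joined in \<open>G\<close> by a path whose inner
  vertices are simplicial in \<open>H\<close> and lie in the same maximal clique. Given an induced net of \<open>H\<close>
  whose triangle \<open>a b c\<close> has no a-heavy pair, simplicial vertices of the clique of the triangle have
  degree at most that of \<open>a\<close>, \<open>b\<close>, \<open>c\<close>; hence connecting \<open>a\<close>, \<open>b\<close>, \<open>c\<close> in \<open>G\<close> through such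
  vertices gives an induced net of \<open>G\<close> without o-heavy pair. This settles the net and the graphs
  contained in it. For P5 and Z2 one may moreover assume that \<open>a b c\<close> is a triangle of \<open>G\<close>, and
  leaves the triangle along the cliques at its corners, using 2-connectedness; for Z2 a single
  configuration survives, in which two legs \<open>a a' r\<close> and \<open>b b' s\<close> return to the clique at \<open>c\<close>. It is
  excluded by counting: within that clique the \<open>G\<close>-neighbours of \<open>r\<close> are pairwise o-heavy, which
  makes \<open>r\<close> have degree less than \<open>n / 2\<close>, and likewise for \<open>s\<close>.
\<close>

section \<open>Graphs\<close>

lemma adj_sym: "adj G u v \<longleftrightarrow> adj G v u"
  by (simp add: adj_def insert_commute)

lemma adj_irrefl: "simple_graph G \<Longrightarrow> \<not> adj G u u"
  by (auto simp: simple_graph_def adj_def)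

lemma adj_verts: "simple_graph G \<Longrightarrow> adj G u v \<Longrightarrow> u \<in> verts G \<and> v \<in> verts G"
  by (auto simp: simple_graph_def adj_def)

lemma adj_mono: "edges G \<subseteq> edges H \<Longrightarrow> adj G u v \<Longrightarrow> adj H u v"
  by (auto simp: adj_def)

lemma finite_verts: "simple_graph G \<Longrightarrow> finite (verts G)"
  by (simp add: simple_graph_def)

lemma mem_nbhd [simp]: "v \<in> nbhd G u \<longleftrightarrow> adj G u v"
  by (simp add: nbhd_def)

lemma nbhd_subset_verts: "simple_graph G \<Longrightarrow> nbhd G x \<subseteq> verts G"
  using adj_verts by fastforce

lemma finite_nbhd: "simple_graph G \<Longrightarrow> finite (nbhd G x)"
  using nbhd_subset_verts finite_verts finite_subset by metis

lemma verts_induced_subgraph [simp]: "verts (induced_subgraph G A) = A"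
  by (simp add: induced_subgraph_def)

lemma adj_induced_subgraph [simp]:
  "adj (induced_subgraph G A) u v \<longleftrightarrow> adj G u v \<and> u \<in> A \<and> v \<in> A"
  by (auto simp: induced_subgraph_def adj_def)

lemma verts_local_completion [simp]: "verts (local_completion G x) = verts G"
  by (simp add: local_completion_def)

lemma edges_local_completion: "edges G \<subseteq> edges (local_completion G x)"
  by (auto simp: local_completion_def)

lemma adj_local_completion:
  "adj (local_completion G x) u v \<longleftrightarrow> adj G u v \<or> (adj G x u \<and> adj G x v \<and> u \<noteq> v)"
  by (auto simp: local_completion_def adj_def nbhd_def doubleton_eq_iff insert_commute)

lemma adj_BC_graph:
  "adj (BC_graph G x) u v \<longleftrightarrow>
     adj G u v \<or> (adj G x u \<and> adj G x v \<and> u \<noteq> v \<and> deg G u + deg G v \<ge> card (verts G))"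
  by (auto simp: BC_graph_def adj_def nbhd_def doubleton_eq_iff insert_commute add.commute)

lemma o_heavy_pair_sym: "o_heavy_pair G u v \<longleftrightarrow> o_heavy_pair G v u"
  by (auto simp: o_heavy_pair_def adj_sym add.commute)

lemma deg_mono:
  assumes "simple_graph H" "edges G \<subseteq> edges H"
  shows "deg G u \<le> deg H u"
  unfolding deg_def using finite_nbhd[OF assms(1)] adj_mono[OF assms(2)] by (intro card_mono) auto

lemma deg_strict_mono:
  assumes "simple_graph H" "edges G \<subseteq> edges H" "adj H u v" "\<not> adj G u v"
  shows "deg G u < deg H u"
  unfolding deg_def
proof (rule psubset_card_mono[OF finite_nbhd[OF assms(1)]])
  show "nbhd G u \<subset> nbhd H u"
    using adj_mono[OF assms(2)] assms(3,4) by (auto simp: psubset_eq set_eq_iff)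
qed

lemma o_heavy_pair_mono:
  assumes "simple_graph H" "edges G \<subseteq> edges H" "verts G = verts H" "o_heavy_pair G u v"
    "\<not> adj H u v"
  shows "o_heavy_pair H u v"
  using assms(3-5) deg_mono[OF assms(1,2), of u] deg_mono[OF assms(1,2), of v]
  by (auto simp: o_heavy_pair_def)

lemma card_common_non_nbrs_le:
  assumes "simple_graph G" "card (verts G) \<le> deg G u + deg G v"
    and "W \<subseteq> verts G" "\<And>w. w \<in> W \<Longrightarrow> \<not> adj G u w \<and> \<not> adj G v w"
  shows "card W \<le> card (nbhd G u \<inter> nbhd G v)"
proof -
  let ?U = "nbhd G u \<union> nbhd G v"
  note finite = finite_nbhd[OF assms(1)] finite_subset[OF assms(3) finite_verts[OF assms(1)]]
  have "card W + card ?U = card (W \<union> ?U)"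
    using finite assms(4) by (intro card_Un_disjoint[symmetric]) auto
  also have "\<dots> \<le> card (verts G)"
    using assms(3) nbhd_subset_verts[OF assms(1)]
    by (intro card_mono[OF finite_verts[OF assms(1)]]) auto
  also have "\<dots> \<le> card ?U + card (nbhd G u \<inter> nbhd G v)"
    using assms(2) card_Un_Int[OF finite(1,1)] by (simp add: deg_def)
  finally show ?thesis by simp
qed

lemma card_non_nbrs_le:
  assumes "simple_graph G" "W \<subseteq> verts G" "\<And>w. w \<in> W \<Longrightarrow> \<not> adj G x w"
  shows "card W + deg G x \<le> card (verts G)"
proof -
  have "card W + deg G x = card (W \<union> nbhd G x)"
    unfolding deg_def
    using finite_nbhd[OF assms(1)] finite_subset[OF assms(2) finite_verts[OF assms(1)]] assms(3)
    by (intro card_Un_disjoint[symmetric]) auto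
  also have "\<dots> \<le> card (verts G)"
    using assms(2) nbhd_subset_verts[OF assms(1)]
    by (intro card_mono[OF finite_verts[OF assms(1)]]) auto
  finally show ?thesis .
qed

lemma card_common_non_nbrs_le_half:
  assumes "simple_graph G" "card (verts G) \<le> deg G u + deg G v"
    and "W \<subseteq> verts G" "\<And>w. w \<in> W \<Longrightarrow> \<not> adj G u w \<and> \<not> adj G v w"
  shows "2 * card W \<le> card (verts G)"
  using card_non_nbrs_le[OF assms(1,3), of u] card_non_nbrs_le[OF assms(1,3), of v] assms(2,4)
  by fastforce

definition simplicial :: "'a ugraph \<Rightarrow> 'a \<Rightarrow> bool" where
  "simplicial G x \<longleftrightarrow> is_clique G (nbhd G x)"

lemma simplicialD: "simplicial G x \<Longrightarrow> adj G x u \<Longrightarrow> adj G x v \<Longrightarrow> u \<noteq> v \<Longrightarrow> adj G u v"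
  by (auto simp: simplicial_def is_clique_def)

lemma simplicial_deg_le:
  assumes "simple_graph G" "simplicial G x" "adj G x u"
  shows "deg G x \<le> deg G u"
proof -
  note finite = finite_nbhd[OF assms(1)]
  have "card (nbhd G x) = Suc (card (nbhd G x - {u}))"
    using card_Suc_Diff1[OF finite, of u x] assms(3) by simp
  also have "\<dots> = card (insert x (nbhd G x - {u}))"
    using finite adj_irrefl[OF assms(1)] by simp
  also have "\<dots> \<le> card (nbhd G u)"
    using assms(3)
    by (intro card_mono[OF finite])
      (auto intro!: simplicialD[OF assms(2,3)] simp: adj_sym[of G u x])
  finally show ?thesis by (simp add: deg_def)
qed

lemma nbhd_local_completion_self:
  "simple_graph G \<Longrightarrow> nbhd (local_completion G x) x = nbhd G x"
  by (auto simp: adj_local_completion adj_irrefl)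

lemma simplicial_local_completion_self:
  "simple_graph G \<Longrightarrow> simplicial (local_completion G x) x"
  unfolding simplicial_def nbhd_local_completion_self
  by (simp add: is_clique_def adj_local_completion)

lemma simplicial_local_completion:
  assumes "simple_graph G" "simplicial G y"
  shows "simplicial (local_completion G x) y"
  unfolding simplicial_def is_clique_def
proof (intro ballI impI)
  fix u v
  assume "u \<in> nbhd (local_completion G x) y" "v \<in> nbhd (local_completion G x) y" "u \<noteq> v"
  then show "adj (local_completion G x) u v"
    using simplicialD[OF assms(2)] adj_irrefl[OF assms(1)] adj_sym
    by (metis adj_local_completion mem_nbhd)
qed

definition diamond_free :: "'a ugraph \<Rightarrow> bool" where
  "diamond_free G \<longleftrightarrow> (\<forall>u v w w'.
     adj G u v \<and> adj G u w \<and> adj G v w \<and> adj G u w' \<and> adj G v w' \<and> w \<noteq> w' \<longrightarrow> adj G w w')"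

lemma diamond_freeD:
  "diamond_free G \<Longrightarrow> adj G u v \<Longrightarrow> adj G u w \<Longrightarrow> adj G v w \<Longrightarrow> adj G u w' \<Longrightarrow> adj G v w' \<Longrightarrow>
   w \<noteq> w' \<Longrightarrow> adj G w w'"
  unfolding diamond_free_def by blast

text \<open>Every vertex is adjacent to at most two vertices of an induced 4-cycle \<open>a b c d\<close>.\<close>
lemma diamond_free_C4_deg_sum_le:
  assumes "simple_graph G" "diamond_free G"
    and "adj G a b" "adj G b c" "adj G c d" "adj G d a" "a \<noteq> c" "b \<noteq> d"
    and "\<not> adj G a c" "\<not> adj G b d"
  shows "deg G a + deg G b + deg G c + deg G d \<le> 2 * card (verts G)"
proof -
  note finite = finite_nbhd[OF assms(1)]
  have opposite_edges: "card (nbhd G p \<inter> nbhd G q) + card (nbhd G r \<union> nbhd G s) \<le> card (verts G)"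
    if C4: "adj G p q" "adj G q r" "adj G s p" "p \<noteq> r" "q \<noteq> s" "\<not> adj G p r" "\<not> adj G q s"
    for p q r s
  proof -
    have "\<not> adj G r w \<and> \<not> adj G s w" if "adj G p w" "adj G q w" for w
      using diamond_freeD[OF assms(2), of p w q s] diamond_freeD[OF assms(2), of q w p r] C4 that
      by (metis adj_sym)
    then have "card (nbhd G p \<inter> nbhd G q) + card (nbhd G r \<union> nbhd G s) =
        card ((nbhd G p \<inter> nbhd G q) \<union> (nbhd G r \<union> nbhd G s))"
      using finite by (intro card_Un_disjoint[symmetric]) auto
    also have "\<dots> \<le> card (verts G)"
      using nbhd_subset_verts[OF assms(1)]
      by (intro card_mono[OF finite_verts[OF assms(1)]]) blast
    finally show ?thesis .
  qed
  have "card (nbhd G a \<inter> nbhd G b) + card (nbhd G c \<union> nbhd G d) \<le> card (verts G)"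
    "card (nbhd G c \<inter> nbhd G d) + card (nbhd G a \<union> nbhd G b) \<le> card (verts G)"
    using opposite_edges[of a b c d] opposite_edges[of c d a b] assms(3-) by (simp_all add: adj_sym)
  moreover have "deg G a + deg G b = card (nbhd G a \<union> nbhd G b) + card (nbhd G a \<inter> nbhd G b)"
    "deg G c + deg G d = card (nbhd G c \<union> nbhd G d) + card (nbhd G c \<inter> nbhd G d)"
    unfolding deg_def by (rule card_Un_Int[OF finite finite])+
  ultimately show ?thesis by linarith
qed

lemma rtranclp_crosses:
  assumes "r\<^sup>*\<^sup>* u v" "u \<in> S" "v \<notin> S"
  obtains y z where "r y z" "y \<in> S" "z \<notin> S"
proof -
  have "\<exists>y z. r y z \<and> y \<in> S \<and> z \<notin> S"
    using assms by (induction rule: rtranclp_induct) blast+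
  then show thesis using that by blast
qed

section \<open>Heavy induced subgraphs\<close>

definition induced_embedding :: "('b \<Rightarrow> 'a) \<Rightarrow> 'b ugraph \<Rightarrow> 'a ugraph \<Rightarrow> bool" where
  "induced_embedding f P G \<longleftrightarrow> inj_on f (verts P) \<and> f ` verts P \<subseteq> verts G \<and>
     (\<forall>i\<in>verts P. \<forall>j\<in>verts P. adj G (f i) (f j) \<longleftrightarrow> adj P i j)"

lemma induced_embeddingD:
  assumes "induced_embedding f P G" "i \<in> verts P" "j \<in> verts P"
  shows "f i \<in> verts G" "adj G (f i) (f j) \<longleftrightarrow> adj P i j" "f i = f j \<longleftrightarrow> i = j"
  using assms by (auto simp: induced_embedding_def inj_on_eq_iff)

lemma graph_iso_induced_subgraph_iff:
  "A \<subseteq> verts G \<Longrightarrow>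
   graph_iso f P (induced_subgraph G A) \<longleftrightarrow> induced_embedding f P G \<and> f ` verts P = A"
  by (auto simp: graph_iso_def induced_embedding_def bij_betw_def)

lemma induced_embedding_comp:
  assumes "induced_embedding f P Q" "induced_embedding g Q G"
  shows "induced_embedding (g \<circ> f) P G"
  using assms by (simp add: induced_embedding_def inj_on_def image_subset_iff)

lemma o_heavy_iff:
  "o_heavy P G \<longleftrightarrow>
   (\<forall>f. induced_embedding f P G \<longrightarrow> (\<exists>i\<in>verts P. \<exists>j\<in>verts P. o_heavy_pair G (f i) (f j)))"
proof -
  have "A \<subseteq> verts G \<and> graph_iso f P (induced_subgraph G A) \<longleftrightarrow>
      induced_embedding f P G \<and> A = f ` verts P" for A f
    using graph_iso_induced_subgraph_iff[of A G f P] by (auto simp: induced_embedding_def)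
  moreover have "o_heavy P G \<longleftrightarrow> (\<forall>A f. A \<subseteq> verts G \<and> graph_iso f P (induced_subgraph G A) \<longrightarrow>
      (\<exists>u\<in>A. \<exists>v\<in>A. o_heavy_pair G u v))"
    by (auto simp: o_heavy_def isomorphic_def)
  ultimately show ?thesis by simp
qed

lemma o_heavy_if_embeds:
  assumes "induced_embedding f P Q" "o_heavy P G"
  shows "o_heavy Q G"
  unfolding o_heavy_iff
proof (intro allI impI)
  fix g assume "induced_embedding g Q G"
  then obtain i j where "i \<in> verts P" "j \<in> verts P" "o_heavy_pair G (g (f i)) (g (f j))"
    using assms(2) induced_embedding_comp[OF assms(1)] unfolding o_heavy_iff by fastforce
  then show "\<exists>i\<in>verts Q. \<exists>j\<in>verts Q. o_heavy_pair G (g i) (g j)"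
    using induced_embeddingD(1)[OF assms(1)] by blast
qed

lemma claw_free_if_no_o_heavy_pair:
  "o_heavy claw G \<Longrightarrow> (\<And>u v. \<not> o_heavy_pair G u v) \<Longrightarrow> claw_free G"
  by (auto simp: o_heavy_def claw_free_def)

definition light_pair :: "'a ugraph \<Rightarrow> 'a \<Rightarrow> 'a \<Rightarrow> bool" where
  "light_pair G u v \<longleftrightarrow>
     u \<in> verts G \<and> v \<in> verts G \<and> u \<noteq> v \<and> \<not> adj G u v \<and> \<not> o_heavy_pair G u v"

lemma light_pair_sym: "light_pair G u v \<longleftrightarrow> light_pair G v u"
  by (auto simp: light_pair_def adj_sym o_heavy_pair_sym)

text \<open>Stated for \<open>i < j\<close> only, so that concrete copies of \<open>P\<close> need each pair just once.\<close>
lemma o_heavy_no_light_copy: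
  fixes P :: "'b::linorder ugraph"
  assumes "simple_graph G" "o_heavy P G" "simple_graph P" "f ` verts P \<subseteq> verts G"
    and pairs: "\<And>i j. i \<in> verts P \<Longrightarrow> j \<in> verts P \<Longrightarrow> i < j \<Longrightarrow>
      if adj P i j then adj G (f i) (f j) else light_pair G (f i) (f j)"
  shows False
proof -
  have all_pairs: "if adj P i j then adj G (f i) (f j) else light_pair G (f i) (f j)"
    if "i \<in> verts P" "j \<in> verts P" "i \<noteq> j" for i j
    using that pairs[of i j] pairs[of j i] adj_sym light_pair_sym by (metis neqE)
  have "f i \<noteq> f j" if "i \<in> verts P" "j \<in> verts P" "i \<noteq> j" for i j
    using all_pairs[OF that] adj_irrefl[OF assms(1)] by (metis light_pair_def)
  moreover have "adj G (f i) (f j) \<longleftrightarrow> adj P i j" if "i \<in> verts P" "j \<in> verts P" for i j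
    using all_pairs[OF that] adj_irrefl[OF assms(1)] adj_irrefl[OF assms(3)]
    by (cases "i = j") (auto simp: light_pair_def split: if_splits)
  ultimately have "induced_embedding f P G"
    unfolding induced_embedding_def inj_on_def using assms(4) by blast
  then obtain i j where ij: "i \<in> verts P" "j \<in> verts P" "o_heavy_pair G (f i) (f j)"
    using assms(2) unfolding o_heavy_iff by blast
  then have "i \<noteq> j" by (auto simp: o_heavy_pair_def)
  with ij show False
    using all_pairs[OF ij(1,2)] by (auto simp: o_heavy_pair_def light_pair_def split: if_splits)
qed

lemma adj_path_graph: "adj (path_graph k) i j \<longleftrightarrow> (j = Suc i \<and> j < k) \<or> (i = Suc j \<and> i < k)"
  by (auto simp: path_graph_def adj_def doubleton_eq_iff)

lemma adj_cycle_graph_3: "adj (cycle_graph 3) i j \<longleftrightarrow> {i, j} \<in> {{0, 1}, {1, 2}, {0, 2}}"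
proof -
  have "{{i, Suc i mod 3} |i. i < 3} = (\<lambda>i. {i, Suc i mod 3}) ` {..<3}" by auto
  also have "\<dots> = {{0, 1}, {1, 2}, {0, 2}}"
    by (simp add: lessThan_nat_numeral lessThan_Suc insert_commute numeral_2_eq_2)
  finally show ?thesis by (simp add: cycle_graph_def adj_def)
qed

lemma adj_Z_graph:
  "adj (Z_graph k) i j \<longleftrightarrow> {i, j} \<in> {{0, 1}, {1, 2}, {0, 2}} \<or>
     (2 \<le> i \<and> j = Suc i \<and> j < k + 3) \<or> (2 \<le> j \<and> i = Suc j \<and> i < k + 3)"
proof -
  have "{i, j} \<in> {{m, Suc m} |m. 2 \<le> m \<and> m < k + 2} \<longleftrightarrow>
      (2 \<le> i \<and> j = Suc i \<and> j < k + 3) \<or> (2 \<le> j \<and> i = Suc j \<and> i < k + 3)"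
    by (auto simp: doubleton_eq_iff)
  then show ?thesis by (simp only: Z_graph_def adj_def ugraph.simps Un_iff)
qed

lemma adj_claw: "adj claw i j \<longleftrightarrow> {i, j} \<in> {{0, 1}, {0, 2}, {0, 3}}"
  by (simp add: claw_def adj_def)

lemma adj_bull: "adj bull i j \<longleftrightarrow> {i, j} \<in> {{0, 1}, {1, 2}, {0, 2}, {0, 3}, {1, 4}}"
  by (simp add: bull_def adj_def)

lemma adj_net: "adj net i j \<longleftrightarrow> {i, j} \<in> {{0, 1}, {1, 2}, {0, 2}, {0, 3}, {1, 4}, {2, 5}}"
  by (simp add: net_def adj_def)

lemma verts_path_graph [simp]: "verts (path_graph k) = {..<k}"
  and verts_cycle_graph [simp]: "verts (cycle_graph k) = {..<k}"
  and verts_Z_graph [simp]: "verts (Z_graph k) = {..<k + 3}"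
  and verts_claw [simp]: "verts claw = {0, 1, 2, 3}"
  and verts_bull [simp]: "verts bull = {0, 1, 2, 3, 4}"
  and verts_net [simp]: "verts net = {0, 1, 2, 3, 4, 5}"
  by (simp_all add: path_graph_def cycle_graph_def Z_graph_def claw_def bull_def net_def)

lemma simple_path_graph: "simple_graph (path_graph k)"
  and simple_Z_graph: "simple_graph (Z_graph k)"
  and simple_net: "simple_graph net"
  by (auto simp: simple_graph_def path_graph_def Z_graph_def net_def)

lemma o_heavy_net_if_induced_subgraph:
  assumes "S \<in> {path_graph 4, cycle_graph 3, Z_graph 1, bull, net}" "o_heavy S G"
  shows "o_heavy net G"
proof -
  have "induced_embedding ((!) [3, 0, 1, 4]) (path_graph 4) net"
    by (simp add: induced_embedding_def adj_path_graph adj_net doubleton_eq_iff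
      lessThan_nat_numeral lessThan_Suc inj_on_def)
  moreover have "induced_embedding ((!) [0, 1, 2]) (cycle_graph 3) net"
    by (simp add: induced_embedding_def adj_cycle_graph_3 adj_net doubleton_eq_iff
      lessThan_nat_numeral lessThan_Suc inj_on_def)
  moreover have "induced_embedding ((!) [0, 1, 2, 5]) (Z_graph 1) net"
    by (simp add: induced_embedding_def adj_Z_graph adj_net doubleton_eq_iff
      lessThan_nat_numeral lessThan_Suc inj_on_def)
  moreover have "induced_embedding ((!) [0, 1, 2, 3, 4]) bull net"
    by (simp add: induced_embedding_def adj_bull adj_net doubleton_eq_iff inj_on_def)
  ultimately show ?thesis using assms o_heavy_if_embeds by blast
qed

definition induced_claw :: "'a ugraph \<Rightarrow> 'a \<Rightarrow> 'a \<Rightarrow> 'a \<Rightarrow> 'a \<Rightarrow> bool" where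
  "induced_claw G c u v w \<longleftrightarrow> adj G c u \<and> adj G c v \<and> adj G c w \<and> u \<noteq> v \<and> v \<noteq> w \<and> u \<noteq> w \<and>
     \<not> adj G u v \<and> \<not> adj G v w \<and> \<not> adj G u w"

lemma o_heavy_claw_iff:
  assumes "simple_graph G"
  shows "o_heavy claw G \<longleftrightarrow> (\<forall>c u v w. induced_claw G c u v w \<longrightarrow>
     o_heavy_pair G u v \<or> o_heavy_pair G v w \<or> o_heavy_pair G u w)"
proof (intro iffI allI impI)
  fix c u v w assume heavy: "o_heavy claw G" and claw: "induced_claw G c u v w"
  have "induced_embedding ((!) [c, u, v, w]) claw G"
    using claw adj_irrefl[OF assms] adj_verts[OF assms]
    by (auto simp: induced_claw_def induced_embedding_def adj_claw doubleton_eq_iff adj_sym)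
  then obtain i j where "i \<in> {0, 1, 2, 3}" "j \<in> {0, 1, 2, 3}"
    "o_heavy_pair G ([c, u, v, w] ! i) ([c, u, v, w] ! j)"
    using heavy unfolding o_heavy_iff verts_claw by blast
  then show "o_heavy_pair G u v \<or> o_heavy_pair G v w \<or> o_heavy_pair G u w"
    using claw by (auto simp: o_heavy_pair_def induced_claw_def adj_sym add.commute)
next
  assume heavy: "\<forall>c u v w. induced_claw G c u v w \<longrightarrow>
    o_heavy_pair G u v \<or> o_heavy_pair G v w \<or> o_heavy_pair G u w"
  show "o_heavy claw G"
    unfolding o_heavy_iff
  proof (intro allI impI)
    fix f assume "induced_embedding f claw G"
    note f = induced_embeddingD[OF this]
    have "induced_claw G (f 0) (f 1) (f 2) (f 3)"
      by (simp add: induced_claw_def f adj_claw doubleton_eq_iff)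
    with heavy show "\<exists>i\<in>verts claw. \<exists>j\<in>verts claw. o_heavy_pair G (f i) (f j)"
      by auto
  qed
qed

section \<open>The closure of a claw-o-heavy graph\<close>

lemma o_heavy_pair_if_claw_with_new_edge:
  assumes "simple_graph G" "o_heavy claw G"
    and claw: "induced_claw (local_completion G x) c u v w" and new: "\<not> adj G c u"
  defines "F \<equiv> local_completion G x"
  shows "o_heavy_pair F u v \<or> o_heavy_pair F v w \<or> o_heavy_pair F u w"
proof -
  have simple: "simple_graph F"
    unfolding F_def by (rule simple_graph_local_completion[OF assms(1)])
  have mono: "edges G \<subseteq> edges F" "verts G = verts F"
    by (simp_all add: F_def edges_local_completion)
  have cu: "adj G x c" "adj G x u"
    using claw new by (auto simp: induced_claw_def adj_local_completion)
  have outside: "\<not> adj G x v" "\<not> adj G x w" "x \<noteq> v" "x \<noteq> w"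
    using claw cu adj_sym unfolding induced_claw_def adj_local_completion by metis+
  have "deg G x \<le> deg F u"
    using simplicial_deg_le[OF simple, of x u] simplicial_local_completion_self[OF assms(1)]
      adj_mono[OF mono(1) cu(2)]
    by (simp add: F_def deg_def nbhd_local_completion_self[OF assms(1)])
  then have "o_heavy_pair F u t" if "o_heavy_pair G x t" "t \<in> {v, w}" for t
    using claw that adj_verts[OF assms(1) cu(2)] deg_mono[OF simple mono(1), of t] mono(2)
    unfolding F_def[symmetric] by (auto simp: o_heavy_pair_def induced_claw_def)
  moreover have "induced_claw G c x v w"
    using claw outside cu(1)
    by (auto simp: induced_claw_def adj_local_completion adj_sym[of G c x])
  ultimately show ?thesis
    using assms(2)[unfolded o_heavy_claw_iff[OF assms(1)], rule_format, of c x v w]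
      o_heavy_pair_mono[OF simple mono, of v w] claw
    unfolding F_def[symmetric] by (auto simp: induced_claw_def)
qed

lemma o_heavy_claw_local_completion:
  assumes "simple_graph G" "o_heavy claw G"
  shows "o_heavy claw (local_completion G x)"
  unfolding o_heavy_claw_iff[OF simple_graph_local_completion[OF assms(1)]]
proof (intro allI impI)
  let ?F = "local_completion G x"
  fix c u v w assume claw: "induced_claw ?F c u v w"
  then have perms: "induced_claw ?F c v u w" "induced_claw ?F c w u v"
    by (auto simp: induced_claw_def adj_sym)
  note new_edge = o_heavy_pair_if_claw_with_new_edge[OF assms]
  consider "\<not> adj G c u" | "\<not> adj G c v" | "\<not> adj G c w" | "induced_claw G c u v w"
    using claw adj_mono[OF edges_local_completion[of G x]] by (auto simp: induced_claw_def)
  then show "o_heavy_pair ?F u v \<or> o_heavy_pair ?F v w \<or> o_heavy_pair ?F u w"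
  proof cases
    case 4
    then have "o_heavy_pair G u v \<or> o_heavy_pair G v w \<or> o_heavy_pair G u w"
      using assms(2) unfolding o_heavy_claw_iff[OF assms(1)] by blast
    then show ?thesis
      using o_heavy_pair_mono[OF simple_graph_local_completion[OF assms(1)] edges_local_completion
          verts_local_completion[symmetric]] claw
      unfolding induced_claw_def by blast
  qed (use new_edge[OF claw] new_edge[OF perms(1)] new_edge[OF perms(2)]
      o_heavy_pair_sym[of ?F v u] o_heavy_pair_sym[of ?F w u] o_heavy_pair_sym[of ?F w v] in auto)
qed

lemma closure_steps_invariant:
  assumes "closure_step\<^sup>*\<^sup>* G H" "simple_graph G" "P G"
    and "\<And>F x. simple_graph F \<Longrightarrow> P F \<Longrightarrow> P (local_completion F x)"
  shows "simple_graph H \<and> P H"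
  using assms(1)
proof (induction rule: rtranclp_induct)
  case (step F F')
  then show ?case using assms(4) simple_graph_local_completion by (auto simp: closure_step_def)
qed (use assms(2,3) in simp)

lemma closure_steps_supergraph:
  assumes "closure_step\<^sup>*\<^sup>* G H" "simple_graph G"
  shows "verts H = verts G \<and> edges G \<subseteq> edges H"
  by (rule closure_steps_invariant[OF assms, of "\<lambda>F. verts F = verts G \<and> edges G \<subseteq> edges F",
        THEN conjunct2])
    (auto intro: subsetD[OF edges_local_completion])

lemma closure_steps_simplicial:
  assumes "closure_step\<^sup>*\<^sup>* G H" "simple_graph G" "simplicial G x"
  shows "simplicial H x"
  by (rule closure_steps_invariant[OF assms(1,2), of "\<lambda>F. simplicial F x", THEN conjunct2])
    (simp_all add: assms(3) simplicial_local_completion)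

definition clique_split :: "'a ugraph \<Rightarrow> 'a \<Rightarrow> 'a set \<Rightarrow> 'a set \<Rightarrow> bool" where
  "clique_split G x C D \<longleftrightarrow> C \<noteq> {} \<and> D \<noteq> {} \<and> C \<union> D = nbhd G x \<and> C \<inter> D = {} \<and>
     is_clique (BC_graph G x) C \<and> is_clique (BC_graph G x) D \<and>
     (\<forall>u\<in>C. \<forall>v\<in>D. \<not> adj (BC_graph G x) u v)"

lemma clique_split_sym: "clique_split G x C D \<Longrightarrow> clique_split G x D C"
  by (simp add: clique_split_def Un_commute Int_commute) (metis adj_sym)

lemma clique_split_memE:
  assumes "clique_split G x C D" "adj G x u"
  obtains C' D' where "clique_split G x C' D'" "u \<in> C'"
proof -
  have "u \<in> C \<or> u \<in> D" using assms by (auto simp: clique_split_def)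
  then show thesis using that assms(1) clique_split_sym[OF assms(1)] by blast
qed

lemma two_cliques_if_not_connected:
  assumes "A \<noteq> {}" "\<not> connected_graph (induced_subgraph B A)"
    and triple: "\<And>u v w. {u, v, w} \<subseteq> A \<Longrightarrow> distinct [u, v, w] \<Longrightarrow> adj B u v \<or> adj B v w \<or> adj B u w"
  obtains C D where "C \<noteq> {}" "D \<noteq> {}" "C \<union> D = A" "C \<inter> D = {}" "is_clique B C" "is_clique B D"
    "\<forall>u\<in>C. \<forall>v\<in>D. \<not> adj B u v"
proof -
  let ?I = "induced_subgraph B A"
  obtain p q where pq: "p \<in> A" "q \<in> A" "\<not> (adj ?I)\<^sup>*\<^sup>* p q"
    using assms(1,2) by (auto simp: connected_graph_def)
  define C where "C = {u \<in> A. (adj ?I)\<^sup>*\<^sup>* p u}"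
  have p: "p \<in> C" and q: "q \<in> A - C" using pq by (auto simp: C_def)
  have separated: "\<not> adj B u v" if "u \<in> C" "v \<in> A - C" for u v
  proof
    assume "adj B u v"
    with that have "adj ?I u v" "(adj ?I)\<^sup>*\<^sup>* p u" by (simp_all add: C_def)
    then have "(adj ?I)\<^sup>*\<^sup>* p v" by (rule rtranclp.rtrancl_into_rtrancl[rotated])
    with that show False by (simp add: C_def)
  qed
  have "is_clique B C"
    unfolding is_clique_def
  proof (intro ballI impI)
    fix u v assume "u \<in> C" "v \<in> C" "u \<noteq> v"
    then show "adj B u v" using triple[of u v q] separated q by (auto simp: C_def)
  qed
  moreover have "is_clique B (A - C)"
    unfolding is_clique_def
  proof (intro ballI impI)
    fix u v assume "u \<in> A - C" "v \<in> A - C" "u \<noteq> v"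
    then show "adj B u v" using triple[of p u v] separated p by (auto simp: C_def)
  qed
  ultimately show thesis
    using that[of C "A - C"] p q separated by (auto simp: C_def)
qed

lemma ex_clique_split:
  assumes "simple_graph G" "o_heavy claw G" "\<not> c_eligible G x" "x \<in> verts G" "\<not> simplicial G x"
  shows "\<exists>C D. clique_split G x C D"
proof -
  let ?B = "BC_graph G x"
  have triple: "adj ?B u v \<or> adj ?B v w \<or> adj ?B u w"
    if "{u, v, w} \<subseteq> nbhd G x" "distinct [u, v, w]" for u v w
    using assms(2)[unfolded o_heavy_claw_iff[OF assms(1)], rule_format, of x u v w] that
    by (auto simp: adj_BC_graph induced_claw_def o_heavy_pair_def)
  have "nbhd G x \<noteq> {}" "\<not> connected_graph (induced_subgraph ?B (nbhd G x))"
    using assms(3-5) by (auto simp: c_eligible_def simplicial_def is_clique_def)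
  from two_cliques_if_not_connected[OF this triple] show ?thesis
    unfolding clique_split_def by metis
qed

lemma c_eligible_if_clique_split:
  assumes "clique_split G x C D" "o_heavy_pair G x z"
    and "p \<in> C" "q \<in> D" "adj G z p" "adj G z q"
  shows "c_eligible G x"
  unfolding c_eligible_def
proof (intro conjI disjI2 exI)
  show "\<not> is_clique G (nbhd G x)"
  proof -
    have "p \<in> nbhd G x" "q \<in> nbhd G x" "p \<noteq> q" "\<not> adj G p q"
      using assms(1,3,4) unfolding clique_split_def adj_BC_graph by blast+
    then show ?thesis unfolding is_clique_def by blast
  qed
  show "C \<union> D = nbhd G x" "C \<inter> D = {}" "is_clique (BC_graph G x) C" "is_clique (BC_graph G x) D"
    "\<forall>u\<in>C. \<forall>v\<in>D. \<not> adj (BC_graph G x) u v"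
    using assms(1) by (simp_all add: clique_split_def)
  show "x \<in> verts G" using assms(2) by (simp add: o_heavy_pair_def)
  show "o_heavy_pair G x z" "\<exists>p\<in>C. adj G z p" "\<exists>q\<in>D. adj G z q" using assms(2-6) by blast+
qed

locale closed_graph =
  fixes H :: "'a ugraph"
  assumes simple_H: "simple_graph H" and o_heavy_claw_H: "o_heavy claw H"
    and not_c_eligible: "x \<in> verts H \<Longrightarrow> \<not> c_eligible H x"
begin

lemma clique_split_common_nbr:
  assumes "o_heavy_pair H x z" "clique_split H x C D" "p \<in> C" "q \<in> D" "adj H z p"
  shows "\<not> adj H z q"
  using c_eligible_if_clique_split[OF assms(2,1,3,4,5)] not_c_eligible assms(1)
  by (auto simp: o_heavy_pair_def)

lemma common_nbrs_adj_or_o_heavy: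
  assumes heavy: "o_heavy_pair H x z"
    and common: "u \<in> nbhd H x \<inter> nbhd H z" "v \<in> nbhd H x \<inter> nbhd H z"
    and "u \<noteq> v"
  shows "adj H u v \<or> o_heavy_pair H u v"
proof (cases "simplicial H x")
  case True
  then show ?thesis using simplicialD[of H x u v] common \<open>u \<noteq> v\<close> by simp
next
  case False
  have x: "x \<in> verts H" using heavy by (simp add: o_heavy_pair_def)
  obtain C D where split: "clique_split H x C D"
    using ex_clique_split[OF simple_H o_heavy_claw_H not_c_eligible[OF x] x False] by blast
  then have "u \<in> C \<union> D" "v \<in> C \<union> D" using common by (auto simp: clique_split_def)
  then have "adj (BC_graph H x) u v"
    using clique_split_common_nbr[OF heavy split]
      clique_split_common_nbr[OF heavy clique_split_sym[OF split]]
      split common \<open>u \<noteq> v\<close>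
    unfolding clique_split_def is_clique_def mem_nbhd Int_iff Un_iff by blast
  then show ?thesis
    using \<open>u \<noteq> v\<close> adj_verts[OF simple_H] unfolding adj_BC_graph o_heavy_pair_def by blast
qed

lemma ex_private_nbr:
  assumes heavy: "o_heavy_pair H x z" and y: "y \<in> nbhd H x \<inter> nbhd H z"
  shows "\<exists>w. adj H y w \<and> w \<in> verts H - (nbhd H x \<union> nbhd H z \<union> {x, z}) \<and>
    (\<forall>m\<in>nbhd H x \<inter> nbhd H z. adj H m w \<longrightarrow> m = y)"
proof -
  have xyz: "adj H y x" "adj H y z" "y \<in> verts H" "x \<noteq> z" "\<not> adj H x z"
    using heavy y adj_verts[OF simple_H] by (auto simp: o_heavy_pair_def adj_sym)
  then have "\<not> simplicial H y" using simplicialD[of H y x z] by blast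
  then obtain C D where split: "clique_split H y C D" and x: "x \<in> C"
    using ex_clique_split[OF simple_H o_heavy_claw_H not_c_eligible[OF xyz(3)] xyz(3)]
    by (metis clique_split_memE[OF _ xyz(1)])
  have nbrs: "u \<in> C \<or> u \<in> D" if "adj H y u" for u
    using split that by (auto simp: clique_split_def)
  have "adj (BC_graph H y) x z"
    using heavy xyz by (simp add: adj_BC_graph o_heavy_pair_def)
  then have z: "z \<in> C" using split x nbrs[OF xyz(2)] by (auto simp: clique_split_def)
  obtain w where w: "w \<in> D" using split by (auto simp: clique_split_def)
  have yw: "adj H y w" using split w by (auto simp: clique_split_def)
  have separated: "\<not> adj H u w" if "u \<in> C" for u
    using split w that by (auto simp: clique_split_def adj_BC_graph)
  have unique: "m = y" if m: "m \<in> nbhd H x \<inter> nbhd H z" "adj H m w" for m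
  proof (rule ccontr)
    assume "m \<noteq> y"
    moreover have mx: "adj H m x" using m by (simp add: adj_sym)
    ultimately consider "adj H y m" | "o_heavy_pair H y m"
      using common_nbrs_adj_or_o_heavy[OF heavy m(1) y] adj_sym o_heavy_pair_sym by metis
    then show False
    proof cases
      case 1
      then have "m \<in> D" using separated m(2) nbrs by blast
      then show False using split x mx by (auto simp: clique_split_def adj_BC_graph adj_sym)
    next
      case 2
      then show False using clique_split_common_nbr[OF 2 split x w mx] m(2) by simp
    qed
  qed
  have "w \<notin> nbhd H x \<union> nbhd H z \<union> {x, z}"
    using separated x z w split by (auto simp: clique_split_def)
  then show ?thesis using yw adj_verts[OF simple_H yw] unique by blast
qed

text \<open>
  The common neighbours of an o-heavy pair would have pairwise distinct private neighbours
  outside \<open>N[x] \<union> N[z]\<close>: more vertices than there are.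
\<close>
lemma no_o_heavy_pair: "\<not> o_heavy_pair H x z"
proof
  assume heavy: "o_heavy_pair H x z"
  let ?M = "nbhd H x \<inter> nbhd H z"
  obtain f where f: "\<And>y. y \<in> ?M \<Longrightarrow> adj H y (f y)"
    "\<And>y. y \<in> ?M \<Longrightarrow> f y \<in> verts H - (nbhd H x \<union> nbhd H z \<union> {x, z})"
    "\<And>y m. y \<in> ?M \<Longrightarrow> m \<in> ?M \<Longrightarrow> adj H m (f y) \<Longrightarrow> m = y"
    using ex_private_nbr[OF heavy] by metis
  have "inj_on f ?M" using f by (metis inj_onI)
  then have "card ?M = card (f ` ?M)" by (rule card_image[symmetric])
  moreover have "card (f ` ?M \<union> {x, z}) = card (f ` ?M) + card {x, z}"
  proof (rule card_Un_disjoint)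
    show "f ` ?M \<inter> {x, z} = {}" using f(2) by blast
  qed (simp_all add: finite_nbhd[OF simple_H])
  moreover have "card (f ` ?M \<union> {x, z}) \<le> card ?M"
  proof (rule card_common_non_nbrs_le[OF simple_H])
    show "f ` ?M \<union> {x, z} \<subseteq> verts H" using f(2) heavy by (auto simp: o_heavy_pair_def)
    show "\<not> adj H x w \<and> \<not> adj H z w" if "w \<in> f ` ?M \<union> {x, z}" for w
      using that f(2) heavy adj_irrefl[OF simple_H] by (auto simp: o_heavy_pair_def adj_sym)
  qed (use heavy in \<open>simp add: o_heavy_pair_def\<close>)
  ultimately show False using heavy by (simp add: o_heavy_pair_def)
qed

lemma claw_free_H: "claw_free H"
  by (rule claw_free_if_no_o_heavy_pair[OF o_heavy_claw_H no_o_heavy_pair])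

lemma no_independent_nbrs:
  assumes "adj H c u" "adj H c v" "adj H c w" "u \<noteq> v" "v \<noteq> w" "u \<noteq> w"
  shows "adj H u v \<or> adj H v w \<or> adj H u w"
  using o_heavy_claw_H[unfolded o_heavy_claw_iff[OF simple_H], rule_format, of c u v w] assms
    no_o_heavy_pair
  by (auto simp: induced_claw_def)

lemma adj_BC_graph_H: "adj (BC_graph H x) u v \<longleftrightarrow> adj H u v"
  using no_o_heavy_pair[of u v] adj_verts[OF simple_H]
  by (auto simp: adj_BC_graph o_heavy_pair_def)

lemma diamond_free_H: "diamond_free H"
  unfolding diamond_free_def
proof (intro allI impI, elim conjE)
  fix u v w w'
  assume diamond: "adj H u v" "adj H u w" "adj H v w" "adj H u w'" "adj H v w'" "w \<noteq> w'"
  show "adj H w w'"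
  proof (cases "simplicial H u")
    case True
    then show ?thesis using simplicialD diamond by metis
  next
    case False
    have u: "u \<in> verts H" using adj_verts[OF simple_H diamond(1)] by simp
    obtain C D where split: "clique_split H u C D"
      using ex_clique_split[OF simple_H o_heavy_claw_H not_c_eligible[OF u] u False] by blast
    then have "v \<in> C \<union> D" "w \<in> C \<union> D" "w' \<in> C \<union> D" using diamond by (auto simp: clique_split_def)
    then show ?thesis
      using split diamond adj_sym[of H v w] adj_sym[of H v w']
      unfolding clique_split_def adj_BC_graph_H is_clique_def by blast
  qed
qed

end

definition simplicial_hull :: "'a ugraph \<Rightarrow> 'a set \<Rightarrow> 'a set" where
  "simplicial_hull H S = S \<union> {w. simplicial H w \<and> S \<subseteq> nbhd H w}"

lemma simplicial_hull_edge_mem: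
  assumes "diamond_free H" "adj H u v" "x \<in> simplicial_hull H {u, v}"
    "y \<in> simplicial_hull H {u, v}"
    and "adj H x y" "simplicial H w" "adj H w x" "adj H w y"
  shows "w \<in> simplicial_hull H {u, v}"
proof -
  have "w = t \<or> adj H w t" if t: "t \<in> {u, v}" for t
  proof (cases "t \<in> {x, y}")
    case False
    then have "adj H x t" "adj H y t"
      using assms(2-4) t adj_sym[of H u v] by (auto simp: simplicial_hull_def)
    then show ?thesis using diamond_freeD[OF assms(1,5), of w t] assms(7,8) adj_sym by metis
  qed (use assms(7,8) in auto)
  then show ?thesis using assms(6) by (auto simp: simplicial_hull_def)
qed

text \<open>
  The centre of a local completion is simplicial from then on, so every edge it adds can be
  replaced by a path of length two through a vertex that is simplicial in the closure.
\<close>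
lemma closure_edge_connected_in_hull:
  assumes "closure_step\<^sup>*\<^sup>* G H" "simple_graph G" "diamond_free H" "adj H u v"
  shows "(adj (induced_subgraph G (simplicial_hull H {u, v})))\<^sup>*\<^sup>* u v"
  using assms(1,2)
proof (induction rule: converse_rtranclp_induct)
  case base
  have "adj (induced_subgraph H (simplicial_hull H {u, v})) u v"
    using assms(4) by (simp add: simplicial_hull_def)
  then show ?case by blast
next
  case (step G G')
  let ?X = "simplicial_hull H {u, v}"
  obtain c where c: "G' = local_completion G c"
    using step.hyps(1) by (auto simp: closure_step_def)
  have simple': "simple_graph G'"
    unfolding c by (rule simple_graph_local_completion[OF step.prems])
  have "simplicial H c"
    using closure_steps_simplicial[OF step.hyps(2) simple']
      simplicial_local_completion_self[OF step.prems] c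
    by blast
  note mono' = adj_mono[OF closure_steps_supergraph[OF step.hyps(2) simple', THEN conjunct2]]
  have mono: "adj H x y" if "adj G x y" for x y
    using mono' that by (simp add: c adj_local_completion)
  have "(adj (induced_subgraph G ?X))\<^sup>*\<^sup>* x y" if xy: "adj (induced_subgraph G' ?X) x y" for x y
  proof (cases "adj G x y")
    case False
    then have cxy: "adj G c x" "adj G c y" using xy by (auto simp: c adj_local_completion)
    have "adj H x y" using mono' xy by simp
    then have "c \<in> ?X"
      using simplicial_hull_edge_mem[OF assms(3,4), of x y c] xy cxy mono \<open>simplicial H c\<close> by simp
    then have "adj (induced_subgraph G ?X) x c" "adj (induced_subgraph G ?X) c y"
      using xy cxy adj_sym[of G c x] by simp_all
    then show ?thesis by (rule converse_rtranclp_into_rtranclp[OF _ r_into_rtranclp])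
  qed (use xy in auto)
  then have "adj (induced_subgraph G' ?X) \<le> (adj (induced_subgraph G ?X))\<^sup>*\<^sup>*" by blast
  from predicate2D[OF rtranclp_mono[OF this] step.IH[OF simple']] show ?case
    by (simp only: rtranclp_idemp)
qed

section \<open>Light paths\<close>

fun light_path :: "'a ugraph \<Rightarrow> 'a list \<Rightarrow> bool" where
  "light_path G [] \<longleftrightarrow> True"
| "light_path G [x] \<longleftrightarrow> x \<in> verts G"
| "light_path G (x # y # zs) \<longleftrightarrow> adj G x y \<and> (\<forall>z\<in>set zs. light_pair G x z) \<and> light_path G (y # zs)"

lemma light_path_appendD: "light_path G (us @ vs) \<Longrightarrow> light_path G vs"
proof (induction us)
  case (Cons u us)
  then show ?case by (cases "us @ vs") auto
qed simp

lemma light_path_append_adj: "light_path G (us @ x # y # vs) \<Longrightarrow> adj G x y"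
  using light_path_appendD[of G us "x # y # vs"] by simp

lemma light_path_append_light:
  "light_path G (us @ y # vs) \<Longrightarrow> u \<in> set us \<Longrightarrow> v \<in> set vs \<Longrightarrow> light_pair G u v"
proof (induction us)
  case (Cons x us)
  then show ?case by (cases us) auto
qed simp

lemma light_path_snoc:
  assumes "light_path G (xs @ [y])" "adj G y z" "z \<in> verts G" "\<And>x. x \<in> set xs \<Longrightarrow> light_pair G x z"
  shows "light_path G (xs @ [y, z])"
  using assms(1,4)
proof (induction xs)
  case Nil
  then show ?case using assms(2,3) by simp
next
  case (Cons x xs)
  then show ?case by (cases xs) auto
qed

lemma light_path_rev: "simple_graph G \<Longrightarrow> light_path G xs \<Longrightarrow> light_path G (rev xs)"
proof (induction G xs rule: light_path.induct)
  case (3 G x y zs)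
  then have "light_path G (rev zs @ [y, x])"
    using adj_verts[of G x y] by (intro light_path_snoc) (auto simp: adj_sym light_pair_sym)
  then show ?case by simp
qed simp_all

lemma set_light_path_subset: "simple_graph G \<Longrightarrow> light_path G xs \<Longrightarrow> set xs \<subseteq> verts G"
proof (induction G xs rule: light_path.induct)
  case (3 G x y zs)
  then show ?case using adj_verts[of G x y] by auto
qed auto

lemma distinct_light_path: "simple_graph G \<Longrightarrow> light_path G xs \<Longrightarrow> distinct xs"
proof (induction G xs rule: light_path.induct)
  case (3 G x y zs)
  then show ?case using adj_irrefl[of G x] by (auto simp: light_pair_def)
qed auto

lemma light_path_nth:
  "light_path G xs \<Longrightarrow> i < j \<Longrightarrow> j < length xs \<Longrightarrow>
   if j = Suc i then adj G (xs ! i) (xs ! j) else light_pair G (xs ! i) (xs ! j)"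
proof (induction G xs arbitrary: i j rule: light_path.induct)
  case (3 G x y zs)
  then obtain j' where j: "j = Suc j'" by (cases j) auto
  show ?case
  proof (cases i)
    case 0
    then show ?thesis using "3.prems" j by (cases j') auto
  next
    case (Suc i')
    then show ?thesis using "3.IH"[of i' j'] "3.prems"
      unfolding j by (auto simp del: nth_Cons_pos split: if_splits)
  qed
qed auto

lemma length_light_path_less:
  assumes "simple_graph G" "o_heavy (path_graph k) G" "light_path G xs"
  shows "length xs < k"
proof (rule ccontr)
  assume long: "\<not> length xs < k"
  show False
  proof (rule o_heavy_no_light_copy[OF assms(1,2) simple_path_graph])
    show "(!) xs ` verts (path_graph k) \<subseteq> verts G"
      using long set_light_path_subset[OF assms(1,3)] by (auto simp: subset_iff)
    show "if adj (path_graph k) i j then adj G (xs ! i) (xs ! j)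
      else light_pair G (xs ! i) (xs ! j)"
      if "i \<in> verts (path_graph k)" "j \<in> verts (path_graph k)" "i < j" for i j
      using light_path_nth[OF assms(3), of i j] that long by (auto simp: adj_path_graph)
  qed
qed

lemma adj_Z_graph_less:
  "i < j \<Longrightarrow> adj (Z_graph k) i j \<longleftrightarrow> j \<le> 2 \<or> 2 \<le> i \<and> j = Suc i \<and> j < k + 3"
  by (auto simp: adj_Z_graph doubleton_eq_iff)

lemma length_light_tail_less:
  assumes "simple_graph G" "o_heavy (Z_graph k) G" "light_path G (z # xs)"
    and triangle: "adj G x y" "adj G x z" "adj G y z"
    and light: "\<And>v. v \<in> set xs \<Longrightarrow> light_pair G x v \<and> light_pair G y v"
  shows "length xs < k"
proof (rule ccontr)
  assume long: "\<not> length xs < k"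
  let ?f = "(!) (x # y # z # xs)"
  show False
  proof (rule o_heavy_no_light_copy[OF assms(1,2) simple_Z_graph])
    have "set (x # y # z # xs) \<subseteq> verts G"
      using set_light_path_subset[OF assms(1,3)] adj_verts[OF assms(1) triangle(1)] by simp
    then show "?f ` verts (Z_graph k) \<subseteq> verts G"
      using long by (auto simp: subset_iff simp del: set_simps intro!: nth_mem)
    fix i j assume ij: "i \<in> verts (Z_graph k)" "j \<in> verts (Z_graph k)" "i < j"
    have "i < 2 \<and> (j = 1 \<or> j = 2) \<or> i < 2 \<and> j = (j - 3) + 3 \<or> i = (i - 2) + 2 \<and> j = (j - 2) + 2"
      using ij(3) by linarith
    then consider "i < 2" "j = 1 \<or> j = 2" | m where "i < 2" "j = m + 3"
      | l m where "i = l + 2" "j = m + 2" by blast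
    then show "if adj (Z_graph k) i j then adj G (?f i) (?f j) else light_pair G (?f i) (?f j)"
    proof cases
      case 1
      then show ?thesis using ij(3) triangle by (auto simp: adj_Z_graph_less less_2_cases_iff)
    next
      case (2 m)
      then have "xs ! m \<in> set xs" using ij long by simp
      then show ?thesis using 2 light by (auto simp: adj_Z_graph_less less_2_cases_iff)
    next
      case (3 l m)
      then show ?thesis
        using light_path_nth[OF assms(3), of l m] ij long
        by (auto simp: adj_Z_graph_less split: if_splits)
    qed
  qed
qed

lemma ex_light_path:
  assumes "X \<subseteq> verts G" "v \<in> X" "(adj (induced_subgraph G X))\<^sup>*\<^sup>* u v"
    and light: "\<And>x y. x \<in> X \<Longrightarrow> y \<in> X \<Longrightarrow> x \<noteq> y \<Longrightarrow> \<not> adj G x y \<Longrightarrow> light_pair G x y"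
  shows "\<exists>xs. light_path G (u # xs) \<and> last (u # xs) = v \<and> set (u # xs) \<subseteq> X"
  using assms(3)
proof (induction rule: converse_rtranclp_induct)
  case base
  have "light_path G [v] \<and> last [v] = v \<and> set [v] \<subseteq> X" using assms(1,2) by auto
  then show ?case by blast
next
  case (step u y)
  then obtain xs where xs: "light_path G (y # xs)" "last (y # xs) = v" "set (y # xs) \<subseteq> X" by blast
  have uy: "adj G u y" "u \<in> X" using step.hyps(1) by simp_all
  show ?case
  proof (cases "u \<in> set (y # xs)")
    case True
    then obtain us vs where "y # xs = us @ u # vs" by (meson split_list)
    with xs have "light_path G (u # vs)" "last (u # vs) = v" "set (u # vs) \<subseteq> X"
      using light_path_appendD[of G us "u # vs"] by auto
    then show ?thesis by blast
  next
    case False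
    have "\<exists>t\<in>set (y # xs). adj G u t" using uy by simp
    then obtain us t vs where split: "y # xs = us @ t # vs" "adj G u t" "\<forall>w\<in>set vs. \<not> adj G u w"
      by (metis split_list_last_prop)
    have "light_path G (t # vs)" "last (t # vs) = v" "set (t # vs) \<subseteq> X"
      using xs light_path_appendD[of G us "t # vs"] unfolding split(1) by auto
    moreover from this have "light_pair G u w" if "w \<in> set vs" for w
      using light[of u w] uy split that False by auto
    ultimately have "light_path G (u # t # vs)" "last (u # t # vs) = v" "set (u # t # vs) \<subseteq> X"
      using split uy by auto
    then show ?thesis by blast
  qed
qed

definition light_generalized_net ::
  "'a ugraph \<Rightarrow> 'a list \<Rightarrow> 'a \<Rightarrow> 'a \<Rightarrow> 'a list \<Rightarrow> 'a \<Rightarrow> 'a \<Rightarrow> bool" where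
  "light_generalized_net G us t t' ws q s \<longleftrightarrow> light_path G (us @ t # t' # ws) \<and> us \<noteq> [] \<and> ws \<noteq> [] \<and>
     adj G q t \<and> adj G q t' \<and> adj G q s \<and> (\<forall>x\<in>set us \<union> set ws. light_pair G q x) \<and>
     (\<forall>x\<in>set (us @ t # t' # ws). light_pair G s x)"

lemma light_generalized_net_rev:
  assumes "simple_graph G" "light_generalized_net G us t t' ws q s"
  shows "light_generalized_net G (rev ws) t' t (rev us) q s"
  using assms(2) light_path_rev[OF assms(1), of "us @ t # t' # ws"]
  by (auto simp: light_generalized_net_def)

lemma not_o_heavy_net_if_light_generalized_net:
  assumes "simple_graph G" "light_generalized_net G us t t' ws q s"
  shows "\<not> o_heavy net G"
proof
  assume heavy: "o_heavy net G"
  obtain us' l r ws' where l: "us = us' @ [l]" and r: "ws = r # ws'"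
    using assms(2) by (metis rev_exhaust list.exhaust light_generalized_net_def)
  have path: "light_path G (us @ t # t' # ws)"
    using assms(2) by (simp add: light_generalized_net_def)
  have edges: "adj G l t" "adj G t t'" "adj G t' r" "adj G q t" "adj G q t'" "adj G q s"
    using assms(2) path light_path_append_adj[of G us' l t]
      light_path_appendD[of G us "t # t' # ws"]
    unfolding l r by (auto simp: light_generalized_net_def)
  have light: "light_pair G l t'" "light_pair G l r" "light_pair G t r" "light_pair G q l"
    "light_pair G q r"
    "light_pair G s l" "light_pair G s r" "light_pair G s t" "light_pair G s t'"
    using assms(2) path light_path_append_light[of G us t "t' # ws"]
      light_path_appendD[of G us "t # t' # ws"]
    unfolding l r by (auto simp: light_generalized_net_def)
  show False
    by (rule o_heavy_no_light_copy[OF assms(1) heavy simple_net, of "(!) [t, t', q, l, r, s]"])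
      (use edges light adj_verts[OF assms(1)] in
        \<open>auto simp: adj_net doubleton_eq_iff adj_sym light_pair_sym\<close>)
qed

lemma light_generalized_net_length_less:
  assumes "simple_graph G" "o_heavy (Z_graph k) G" "light_generalized_net G us t t' ws q s"
  shows "length us < k" "length ws < k"
proof -
  have "length ws < k" if gn: "light_generalized_net G us t t' ws q s" for us t t' ws
  proof (rule length_light_tail_less[OF assms(1,2), where x = q and y = t])
    have path: "light_path G (t # t' # ws)"
      using gn light_path_appendD[of G us "t # t' # ws"] by (simp add: light_generalized_net_def)
    then show "light_path G (t' # ws)" "adj G t t'" by simp_all
    show "adj G q t" "adj G q t'" using gn by (simp_all add: light_generalized_net_def)
    show "light_pair G q x \<and> light_pair G t x" if "x \<in> set ws" for x
      using gn path that by (simp add: light_generalized_net_def)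
  qed
  from this[OF assms(3)] this[OF light_generalized_net_rev[OF assms(1,3)]]
  show "length us < k" "length ws < k" by simp_all
qed

section \<open>Nets in the closure\<close>

definition induced_net :: "'a ugraph \<Rightarrow> 'a \<Rightarrow> 'a \<Rightarrow> 'a \<Rightarrow> 'a \<Rightarrow> 'a \<Rightarrow> 'a \<Rightarrow> bool" where
  "induced_net H a b c a' b' c' \<longleftrightarrow>
     adj H a b \<and> adj H b c \<and> adj H a c \<and> adj H a a' \<and> adj H b b' \<and> adj H c c' \<and>
     \<not> adj H a b' \<and> \<not> adj H a c' \<and> \<not> adj H b a' \<and> \<not> adj H b c' \<and> \<not> adj H c a' \<and> \<not> adj H c b' \<and>
     \<not> adj H a' b' \<and> \<not> adj H b' c' \<and> \<not> adj H a' c'"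

lemma induced_net_rotate: "induced_net H a b c a' b' c' \<Longrightarrow> induced_net H b c a b' c' a'"
  by (simp add: induced_net_def adj_sym)

lemma induced_net_if_embedding:
  "induced_embedding f net H \<Longrightarrow> induced_net H (f 0) (f 1) (f 2) (f 3) (f 4) (f 5)"
  by (simp add: induced_net_def induced_embeddingD(2) adj_net doubleton_eq_iff)

lemma simplicial_hull_edge_subset_triangle:
  assumes "diamond_free H" "adj H a b" "adj H b c" "adj H a c"
  shows "simplicial_hull H {a, b} \<subseteq> simplicial_hull H {a, b, c}"
proof
  fix x assume "x \<in> simplicial_hull H {a, b}"
  then show "x \<in> simplicial_hull H {a, b, c}"
    using diamond_freeD[OF assms(1,2), of x c] assms(3,4) adj_sym[of H x a] adj_sym[of H x b]
      adj_sym[of H x c]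
    by (cases "x = c") (auto simp: simplicial_hull_def)
qed

locale claw_heavy_closure =
  fixes G H :: "'a ugraph"
  assumes simple_G: "simple_graph G" and o_heavy_claw_G: "o_heavy claw G"
    and closure: "is_cl_c G H"
begin

lemma closure_steps: "closure_step\<^sup>*\<^sup>* G H"
  using closure by (simp add: is_cl_c_def)

lemma verts_H: "verts H = verts G" and edges_subset: "edges G \<subseteq> edges H"
  using closure_steps_supergraph[OF closure_steps simple_G] by simp_all

sublocale closed_graph H
proof
  have "simple_graph H \<and> o_heavy claw H"
    by (rule closure_steps_invariant[of G H "o_heavy claw",
          OF closure_steps simple_G o_heavy_claw_G])
      (rule o_heavy_claw_local_completion)
  then show "simple_graph H" "o_heavy claw H" by simp_all
  show "\<not> c_eligible H x" if "x \<in> verts H" for x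
    using closure that by (simp add: is_cl_c_def)
qed

abbreviation adj_G :: "'a \<Rightarrow> 'a \<Rightarrow> bool" (infix "\<sim>\<^sub>G" 50) where
  "u \<sim>\<^sub>G v \<equiv> adj G u v"

abbreviation adj_H :: "'a \<Rightarrow> 'a \<Rightarrow> bool" (infix "\<sim>\<^sub>H" 50) where
  "u \<sim>\<^sub>H v \<equiv> adj H u v"

abbreviation light :: "'a \<Rightarrow> 'a \<Rightarrow> bool" where
  "light \<equiv> light_pair G"

abbreviation n :: nat where
  "n \<equiv> card (verts G)"

lemma light_sym: "light u v \<Longrightarrow> light v u"
  by (simp add: light_pair_sym)

lemma G_sym: "u \<sim>\<^sub>G v \<Longrightarrow> v \<sim>\<^sub>G u" and H_sym: "u \<sim>\<^sub>H v \<Longrightarrow> v \<sim>\<^sub>H u"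
  by (simp_all add: adj_sym)

lemma G_irrefl: "\<not> u \<sim>\<^sub>G u" and H_irrefl: "\<not> u \<sim>\<^sub>H u"
  using adj_irrefl[OF simple_G] adj_irrefl[OF simple_H] by simp_all

lemma H_if_G: "u \<sim>\<^sub>G v \<Longrightarrow> u \<sim>\<^sub>H v"
  by (rule adj_mono[OF edges_subset])

lemma H_verts: "u \<sim>\<^sub>H v \<Longrightarrow> u \<in> verts G \<and> v \<in> verts G"
  using adj_verts[OF simple_H] verts_H by simp

lemma G_verts: "u \<sim>\<^sub>G v \<Longrightarrow> u \<in> verts G \<and> v \<in> verts G"
  using adj_verts[OF simple_G] .

lemma deg_G_le_H: "deg G u \<le> deg H u"
  by (rule deg_mono[OF simple_H edges_subset])

lemma light_if_not_H_adj: "\<not> u \<sim>\<^sub>H v \<Longrightarrow> u \<noteq> v \<Longrightarrow> u \<in> verts G \<Longrightarrow> v \<in> verts G \<Longrightarrow> light u v"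
  using no_o_heavy_pair[of u v]
    o_heavy_pair_mono[OF simple_H edges_subset verts_H[symmetric], of u v]
    H_if_G[of u v] unfolding light_pair_def by blast

lemma no_light_claw:
  "c \<sim>\<^sub>G u \<Longrightarrow> c \<sim>\<^sub>G v \<Longrightarrow> c \<sim>\<^sub>G w \<Longrightarrow> light u v \<Longrightarrow> light v w \<Longrightarrow> light u w \<Longrightarrow> False"
  using o_heavy_claw_G[unfolded o_heavy_claw_iff[OF simple_G], rule_format, of c u v w]
  by (auto simp: light_pair_def induced_claw_def)

lemma ex_first_link:
  assumes "u \<sim>\<^sub>H v"
  obtains y where "u \<sim>\<^sub>G y" "y = v \<or> simplicial H y \<and> y \<sim>\<^sub>H u \<and> y \<sim>\<^sub>H v"
proof -
  have "u \<noteq> v" using assms H_irrefl by blast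
  then obtain y where "adj (induced_subgraph G (simplicial_hull H {u, v})) u y"
    using closure_edge_connected_in_hull[OF closure_steps simple_G diamond_free_H assms]
    by (metis converse_rtranclpE)
  then show thesis using that[of y] G_irrefl by (auto simp: simplicial_hull_def)
qed

lemma ex_second_link:
  assumes "u \<sim>\<^sub>H v" "\<not> u \<sim>\<^sub>G v"
  obtains y z where "u \<sim>\<^sub>G y" "y \<sim>\<^sub>G z" "\<not> u \<sim>\<^sub>G z" "z \<noteq> u" "simplicial H y" "y \<sim>\<^sub>H u" "y \<sim>\<^sub>H v"
    "z = v \<or> z \<sim>\<^sub>H u \<and> z \<sim>\<^sub>H v"
proof -
  have "u \<in> insert u (nbhd G u)" "v \<notin> insert u (nbhd G u)" using assms H_irrefl by auto
  then obtain y z where yz: "adj (induced_subgraph G (simplicial_hull H {u, v})) y z"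
    "y \<in> insert u (nbhd G u)" "z \<notin> insert u (nbhd G u)"
    by (rule rtranclp_crosses[OF
          closure_edge_connected_in_hull[OF closure_steps simple_G diamond_free_H assms(1)]])
  then have "y \<sim>\<^sub>G z" "u \<sim>\<^sub>G y" "\<not> u \<sim>\<^sub>G z" "z \<noteq> u" by auto
  moreover have "y \<noteq> u" "y \<noteq> v" using calculation(2) assms(2) G_irrefl by blast+
  ultimately show thesis using that[of y z] yz(1) by (auto simp: simplicial_hull_def)
qed

lemma induced_net_replace_leg:
  assumes "induced_net H a b c a' b' c'"
  obtains d where "a \<sim>\<^sub>G d" "induced_net H a b c d b' c'"
proof -
  have "a \<sim>\<^sub>H a'" using assms by (simp add: induced_net_def)
  then obtain y where y: "a \<sim>\<^sub>G y" "y = a' \<or> simplicial H y \<and> y \<sim>\<^sub>H a \<and> y \<sim>\<^sub>H a'"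
    by (rule ex_first_link)
  have "induced_net H a b c y b' c'" if s: "simplicial H y" "y \<sim>\<^sub>H a" "y \<sim>\<^sub>H a'"
  proof -
    have "\<not> y \<sim>\<^sub>H b" "\<not> y \<sim>\<^sub>H c" "\<not> y \<sim>\<^sub>H b'" "\<not> y \<sim>\<^sub>H c'"
      using simplicialD[OF s(1)] s(2,3) assms H_sym H_irrefl unfolding induced_net_def by metis+
    then show ?thesis using assms s(2) unfolding induced_net_def by (simp add: adj_sym)
  qed
  then show thesis using y assms that by blast
qed

text \<open>
  The vertex \<open>q\<close> meets the path in exactly two consecutive vertices, the first of which is \<open>t\<close>:
  one neighbour, or two distant ones, would give a claw with pairwise light leaves.
\<close>
lemma light_generalized_net_if_attached:
  assumes path: "light_path G zs" and t: "zs = us @ t # vs" "q \<sim>\<^sub>G t" "\<And>x. x \<in> set us \<Longrightarrow> \<not> q \<sim>\<^sub>G x"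
    and ends: "\<not> q \<sim>\<^sub>G hd zs" "\<not> q \<sim>\<^sub>G last zs" and "q \<sim>\<^sub>G s"
    and light: "\<And>x. x \<in> set zs \<Longrightarrow> light s x" "\<And>x. x \<in> set zs \<Longrightarrow> \<not> q \<sim>\<^sub>G x \<Longrightarrow> light q x"
  obtains t' ws where "vs = t' # ws" "light_generalized_net G us t t' ws q s"
proof -
  have "us \<noteq> []" "vs \<noteq> []" using ends t by auto
  then obtain us' l t' ws where l: "us = us' @ [l]" and t': "vs = t' # ws"
    by (metis rev_exhaust list.exhaust)
  note cross = light_path_append_light[of G us t vs, folded t(1), OF path]
  have qt': "q \<sim>\<^sub>G t'"
  proof (rule ccontr)
    assume "\<not> q \<sim>\<^sub>G t'"
    then have "light q t'" "light q l" "light l t'" using light(2) t(1,3) cross l t' by auto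
    moreover have "t \<sim>\<^sub>G l" "t \<sim>\<^sub>G t'"
      using path light_path_append_adj[of G us' l t vs] light_path_append_adj[of G us t t' ws]
        G_sym
      unfolding t(1) l t' by auto
    ultimately show False using no_light_claw[of t q l t'] t(2) G_sym by blast
  qed
  then have "ws \<noteq> []" using ends(2) t(1) t' by auto
  moreover have "light q w" if w: "w \<in> set ws" for w
  proof (rule ccontr)
    assume "\<not> light q w"
    then have "q \<sim>\<^sub>G w" using light(2)[of w] w t(1) t' by auto
    moreover have "light t w"
      using light_path_appendD[of G us "t # vs"] path w unfolding t(1) t' by simp
    ultimately show False
      using no_light_claw[of q t w s] t \<open>q \<sim>\<^sub>G s\<close> light(1)[of w] light(1)[of t] light_sym w t'
      by auto
  qed
  moreover have "light q x" if "x \<in> set us" for x using light(2) t(1,3) that by auto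
  ultimately have "light_generalized_net G us t t' ws q s"
    unfolding light_generalized_net_def using path t qt' \<open>us \<noteq> []\<close> \<open>q \<sim>\<^sub>G s\<close> light(1) t' by auto
  then show thesis using that t' by blast
qed

end

locale pendant_net = claw_heavy_closure +
  fixes a b c a' b' c' :: 'a
  assumes net: "induced_net H a b c a' b' c'" and legs: "a \<sim>\<^sub>G a'" "b \<sim>\<^sub>G b'" "c \<sim>\<^sub>G c'"
begin

lemmas legs_H = legs[THEN H_if_G]

lemma net_adj [simp]:
  "a \<sim>\<^sub>H b" "b \<sim>\<^sub>H a" "b \<sim>\<^sub>H c" "c \<sim>\<^sub>H b" "a \<sim>\<^sub>H c" "c \<sim>\<^sub>H a"
  "a \<sim>\<^sub>H a'" "a' \<sim>\<^sub>H a" "b \<sim>\<^sub>H b'" "b' \<sim>\<^sub>H b" "c \<sim>\<^sub>H c'" "c' \<sim>\<^sub>H c"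
  "a' \<sim>\<^sub>G a" "b' \<sim>\<^sub>G b" "c' \<sim>\<^sub>G c"
  using net legs by (auto simp: induced_net_def adj_sym)

lemma net_not_adj [simp]:
  "\<not> a \<sim>\<^sub>H b'" "\<not> b' \<sim>\<^sub>H a" "\<not> a \<sim>\<^sub>H c'" "\<not> c' \<sim>\<^sub>H a" "\<not> b \<sim>\<^sub>H a'" "\<not> a' \<sim>\<^sub>H b"
  "\<not> b \<sim>\<^sub>H c'" "\<not> c' \<sim>\<^sub>H b" "\<not> c \<sim>\<^sub>H a'" "\<not> a' \<sim>\<^sub>H c" "\<not> c \<sim>\<^sub>H b'" "\<not> b' \<sim>\<^sub>H c"
  "\<not> a' \<sim>\<^sub>H b'" "\<not> b' \<sim>\<^sub>H a'" "\<not> b' \<sim>\<^sub>H c'" "\<not> c' \<sim>\<^sub>H b'" "\<not> a' \<sim>\<^sub>H c'" "\<not> c' \<sim>\<^sub>H a'"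
  using net by (auto simp: induced_net_def adj_sym)

lemma net_neq [simp]:
  "a \<noteq> b" "b \<noteq> a" "b \<noteq> c" "c \<noteq> b" "a \<noteq> c" "c \<noteq> a"
  "a \<noteq> a'" "a' \<noteq> a" "a \<noteq> b'" "b' \<noteq> a" "a \<noteq> c'" "c' \<noteq> a"
  "b \<noteq> a'" "a' \<noteq> b" "b \<noteq> b'" "b' \<noteq> b" "b \<noteq> c'" "c' \<noteq> b"
  "c \<noteq> a'" "a' \<noteq> c" "c \<noteq> b'" "b' \<noteq> c" "c \<noteq> c'" "c' \<noteq> c"
  "a' \<noteq> b'" "b' \<noteq> a'" "b' \<noteq> c'" "c' \<noteq> b'" "a' \<noteq> c'" "c' \<noteq> a'"
  using net_adj net_not_adj H_irrefl by metis+

lemma net_verts [simp]: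
  "a \<in> verts G" "b \<in> verts G" "c \<in> verts G" "a' \<in> verts G" "b' \<in> verts G" "c' \<in> verts G"
  using G_verts legs by auto

lemma pendant_net_swap: "pendant_net G H b a c b' a' c'"
  and pendant_net_rotate: "pendant_net G H b c a b' c' a'"
  and pendant_net_rotate': "pendant_net G H c a b c' a' b'"
  using net legs by (unfold_locales; auto simp: induced_net_def adj_sym)+

lemma hull_light_legs:
  assumes "x \<in> simplicial_hull H {a, b, c}"
  shows "x \<noteq> a \<Longrightarrow> light x a'" "x \<noteq> b \<Longrightarrow> light x b'" "x \<noteq> c \<Longrightarrow> light x c'"
proof -
  have x: "x \<in> {a, b, c} \<or> simplicial H x \<and> x \<sim>\<^sub>H a \<and> x \<sim>\<^sub>H b \<and> x \<sim>\<^sub>H c"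
    using assms by (auto simp: simplicial_hull_def)
  then have "x \<in> verts G" "x \<notin> {a', b', c'}" using H_verts by auto
  moreover have "x \<noteq> a \<Longrightarrow> \<not> x \<sim>\<^sub>H a'" "x \<noteq> b \<Longrightarrow> \<not> x \<sim>\<^sub>H b'" "x \<noteq> c \<Longrightarrow> \<not> x \<sim>\<^sub>H c'"
    using x simplicialD[of H x a b'] simplicialD[of H x b a'] simplicialD[of H x a c'] by auto
  ultimately show "x \<noteq> a \<Longrightarrow> light x a'" "x \<noteq> b \<Longrightarrow> light x b'" "x \<noteq> c \<Longrightarrow> light x c'"
    using light_if_not_H_adj by auto
qed

lemma hull_connected: "(adj (induced_subgraph G (simplicial_hull H {a, b, c})))\<^sup>*\<^sup>* a b"
proof -
  have "adj (induced_subgraph G (simplicial_hull H {a, b})) \<le>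
      adj (induced_subgraph G (simplicial_hull H {a, b, c}))"
    using simplicial_hull_edge_subset_triangle[OF diamond_free_H, of a b c] by auto
  from predicate2D[OF rtranclp_mono[OF this]] show ?thesis
    using closure_edge_connected_in_hull[OF closure_steps simple_G diamond_free_H net_adj(1)]
    by blast
qed

end

locale light_net = pendant_net +
  assumes light_triangle: "deg H a + deg H b < n" "deg H b + deg H c < n" "deg H a + deg H c < n"
begin

lemma light_net_rotate: "light_net G H b c a b' c' a'"
  using pendant_net_rotate light_triangle
  by (simp add: light_net_def light_net_axioms_def add.commute)

abbreviation hull :: "'a set" where
  "hull \<equiv> simplicial_hull H {a, b, c}"

lemma hull_light:
  assumes "x \<in> hull" "y \<in> hull" "x \<noteq> y" "\<not> x \<sim>\<^sub>G y"
  shows "light x y"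
proof -
  have small: "w \<in> {a, b, c} \<or> deg H w \<le> deg H a \<and> deg H w \<le> deg H b \<and> deg H w \<le> deg H c"
    and V: "w \<in> verts G" if "w \<in> hull" for w
    using that simplicial_deg_le[OF simple_H] H_verts[of w a] by (auto simp: simplicial_hull_def)
  have "deg H x + deg H y < n"
    using small[OF assms(1)] small[OF assms(2)] assms(3) light_triangle by auto
  then have "deg G x + deg G y < n"
    using deg_G_le_H[of x] deg_G_le_H[of y] by linarith
  then show ?thesis
    using V assms by (simp add: light_pair_def o_heavy_pair_def)
qed

lemma hull_path_avoids_third_corner:
  assumes "light_path G xs" "set xs \<subseteq> hull" "hd xs = a" "last xs = b"
  shows "c \<notin> set xs"
proof
  assume "c \<in> set xs"
  then obtain us vs where split: "xs = us @ c # vs" by (meson split_list)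
  have "us \<noteq> []" "vs \<noteq> []" using assms(3,4) split by auto
  then obtain us' l r vs' where l: "us = us' @ [l]" and r: "vs = r # vs'"
    by (metis rev_exhaust list.exhaust)
  have "c \<sim>\<^sub>G l" "c \<sim>\<^sub>G r" "light l r"
    using light_path_append_adj[of G us' l c] light_path_append_adj[of G us c r vs']
      light_path_append_light[of G us c vs l r] assms(1) G_sym unfolding split l r by auto
  moreover have "light l c'" "light r c'"
    using hull_light_legs(3) distinct_light_path[OF simple_G assms(1)] assms(2)
    unfolding split l r by auto
  ultimately show False using no_light_claw[of c l r c'] legs(3) by blast
qed

lemma ex_light_spine:
  obtains xs where "light_path G (a' # xs @ [b'])" "a \<in> set xs" "b \<in> set xs" "set xs \<subseteq> hull - {c}"
    "xs = [a, b] \<or> 3 \<le> length xs"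
proof -
  have "hull \<subseteq> verts G" using H_verts by (auto simp: simplicial_hull_def)
  moreover have "b \<in> hull" by (simp add: simplicial_hull_def)
  ultimately obtain xs where xs: "light_path G (a # xs)" "last (a # xs) = b" "set (a # xs) \<subseteq> hull"
    using ex_light_path[OF _ _ hull_connected hull_light] by blast
  have distinct: "distinct (a # xs)" by (rule distinct_light_path[OF simple_G xs(1)])
  obtain ys where ys: "a # xs = ys @ [b]"
    using xs(2) by (metis append_butlast_last_id list.distinct(1))
  have "light_path G (ys @ [b, b'])"
  proof (rule light_path_snoc)
    show "light y b'" if "y \<in> set ys" for y
      using hull_light_legs(2)[of y] xs(3) distinct that unfolding ys by auto
  qed (use xs(1) ys legs in auto)
  moreover have "a # xs @ [b'] = ys @ [b, b']"
    using ys by (metis append_Cons append_Nil append_assoc)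
  ultimately have "light_path G (a # xs @ [b'])" by (simp only:)
  moreover have "light a' z" if "z \<in> set (xs @ [b'])" for z
    using hull_light_legs(1)[of z] xs(3) distinct that light_if_not_H_adj[of a' b'] light_sym
    by auto
  ultimately have "light_path G (a' # (a # xs) @ [b'])" by simp
  moreover have "a # xs = [a, b] \<or> 3 \<le> length (a # xs)"
    using xs(2) by (cases xs; cases "tl xs") auto
  ultimately show thesis
    using that[of "a # xs"] hull_path_avoids_third_corner[OF xs(1,3)] xs(2,3)
      last_in_set[of "a # xs"] by auto
qed

lemma ex_attached_vertex:
  assumes "a \<in> P" "b \<in> P" "P \<subseteq> hull - {c}"
  obtains q s t where "q \<in> hull - P" "t \<in> P" "q \<sim>\<^sub>G t" "q \<sim>\<^sub>G s"
    "\<And>x. x \<in> P \<union> {a', b'} \<Longrightarrow> light s x"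
proof (cases "\<exists>t\<in>P. c \<sim>\<^sub>G t")
  case True
  moreover have "light c' x" if "x \<in> P \<union> {a', b'}" for x
    using that hull_light_legs(3)[of x] assms(3) light_if_not_H_adj[of c' x] light_sym by auto
  moreover have "c \<in> hull - P" using assms(3) by (auto simp: simplicial_hull_def)
  ultimately show thesis using that legs(3) by blast
next
  case False
  let ?S = "{x. x \<notin> P \<and> \<not> (\<exists>t\<in>P. x \<sim>\<^sub>G t)}"
  have "(adj (induced_subgraph G hull))\<^sup>*\<^sup>* c a"
    using pendant_net.hull_connected[OF pendant_net_rotate']
    by (simp add: insert_commute)
  moreover have "c \<in> ?S" "a \<notin> ?S" using False assms by auto
  ultimately obtain s q where sq: "adj (induced_subgraph G hull) s q" "s \<in> ?S" "q \<notin> ?S"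
    by (rule rtranclp_crosses)
  then obtain t where t: "t \<in> P" "q \<sim>\<^sub>G t" by auto
  have "light s x" if "x \<in> P \<union> {a', b'}" for x
  proof (cases "x \<in> P")
    case True
    then show ?thesis using hull_light[of s x] sq assms(3) by auto
  next
    case False
    then show ?thesis using hull_light_legs(1,2)[of s] that sq assms(1,2) by auto
  qed
  moreover have "q \<in> hull - P" using sq G_sym by auto
  ultimately show thesis using that[of q t s] t sq(1) G_sym by auto
qed

lemma ex_light_generalized_net:
  obtains us t t' ws q s where "light_generalized_net G us t t' ws q s"
    "a \<sim>\<^sub>G b \<or> 3 \<le> length us + length ws"
proof -
  obtain xs where xs: "light_path G (a' # xs @ [b'])" "a \<in> set xs" "b \<in> set xs"
    "set xs \<subseteq> hull - {c}"
    "xs = [a, b] \<or> 3 \<le> length xs"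
    by (rule ex_light_spine)
  obtain q s t where q: "q \<in> hull - set xs" "t \<in> set xs" "q \<sim>\<^sub>G t" "q \<sim>\<^sub>G s"
    "\<And>x. x \<in> set xs \<union> {a', b'} \<Longrightarrow> light s x"
    using ex_attached_vertex[OF xs(2-4)] by metis
  let ?zs = "a' # xs @ [b']"
  have light: "light q x" if "x \<in> set ?zs" "\<not> q \<sim>\<^sub>G x" for x
    using that q(1) hull_light[of q x] hull_light_legs(1,2)[of q] xs(2-4) by auto
  have ends: "\<not> q \<sim>\<^sub>G a'" "\<not> q \<sim>\<^sub>G b'"
    using hull_light_legs(1,2)[of q] q(1) xs(2,3) by (auto simp: light_pair_def)
  obtain us t vs where split: "?zs = us @ t # vs" "q \<sim>\<^sub>G t" "\<forall>x\<in>set us. \<not> q \<sim>\<^sub>G x"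
    using split_list_first_prop[of ?zs "\<lambda>x. q \<sim>\<^sub>G x"] q(2,3) by auto
  obtain t' ws where "vs = t' # ws" "light_generalized_net G us t t' ws q s"
    by (rule light_generalized_net_if_attached[OF xs(1) split(1,2)])
      (use split(3) ends q(4,5) light in auto)
  moreover from this have "a \<sim>\<^sub>G b \<or> 3 \<le> length us + length ws"
    using arg_cong[OF split(1), of length] xs(1,5) by auto
  ultimately show thesis using that by blast
qed

lemma not_o_heavy_net: "\<not> o_heavy net G"
  using ex_light_generalized_net not_o_heavy_net_if_light_generalized_net[OF simple_G] by metis

lemma adj_if_o_heavy_P5: "a \<sim>\<^sub>G b" if "o_heavy (path_graph 5) G"
proof (rule ex_light_spine)
  fix xs assume "light_path G (a' # xs @ [b'])" "xs = [a, b] \<or> 3 \<le> length xs"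
  then show ?thesis using length_light_path_less[OF simple_G that, of "a' # xs @ [b']"] by auto
qed

lemma adj_if_o_heavy_Z2: "a \<sim>\<^sub>G b" if "o_heavy (Z_graph 2) G"
proof (rule ex_light_generalized_net)
  fix us t t' ws q s
  assume "light_generalized_net G us t t' ws q s" "a \<sim>\<^sub>G b \<or> 3 \<le> length us + length ws"
  then show ?thesis using light_generalized_net_length_less[OF simple_G that] by fastforce
qed

end

section \<open>The cliques at the corners of a net\<close>

context claw_heavy_closure
begin

text \<open>The vertices other than \<open>x\<close> of the maximal clique of \<open>H\<close> through the edge \<open>x x'\<close>.\<close>
definition side :: "'a \<Rightarrow> 'a \<Rightarrow> 'a set" where
  "side x x' = insert x' (nbhd H x \<inter> nbhd H x')"

definition light_side :: "'a \<Rightarrow> 'a \<Rightarrow> bool" where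
  "light_side x x' \<longleftrightarrow> (\<forall>z\<in>side x x'. \<not> o_heavy_pair G x z)"

lemma side_clique:
  assumes "x \<sim>\<^sub>H x'" "u \<in> side x x'" "v \<in> side x x'" "u \<noteq> v"
  shows "u \<sim>\<^sub>H v"
  using assms diamond_freeD[OF diamond_free_H, of x x' u v] H_sym unfolding side_def by auto

lemma side_closed:
  assumes "x \<sim>\<^sub>H x'" "u \<in> side x x'" "u \<sim>\<^sub>H v" "x \<sim>\<^sub>H v"
  shows "v \<in> side x x'"
  using assms diamond_freeD[OF diamond_free_H, of x u v x'] H_sym unfolding side_def by auto

lemma simplicial_side:
  assumes "v \<in> side x x'" "simplicial H v" "v \<sim>\<^sub>H w" "w \<noteq> x" "x \<sim>\<^sub>H x'"
  shows "w \<in> side x x'"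
  using simplicialD[OF assms(2,3), of x] assms side_closed[OF assms(5,1,3)] H_sym
  unfolding side_def by auto

lemma light_if_light_side:
  assumes "light_side x x'" "x \<sim>\<^sub>H x'" "z \<in> side x x'" "\<not> x \<sim>\<^sub>G z"
  shows "light x z"
proof -
  have "x \<sim>\<^sub>H z" using assms(2,3) by (auto simp: side_def)
  then show ?thesis
    using assms H_verts[of x z] H_irrefl by (auto simp: light_side_def light_pair_def)
qed

lemma ex_second_link_in_side:
  assumes "x \<sim>\<^sub>H x'" "z \<in> side x x'" "\<not> x \<sim>\<^sub>G z"
  obtains y w where "x \<sim>\<^sub>G y" "y \<sim>\<^sub>G w" "\<not> x \<sim>\<^sub>G w" "simplicial H y" "y \<in> side x x'"
    "w \<in> side x x'"
proof -
  have "x \<sim>\<^sub>H z" using assms(1,2) by (auto simp: side_def)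
  then obtain y w where yw: "x \<sim>\<^sub>G y" "y \<sim>\<^sub>G w" "\<not> x \<sim>\<^sub>G w" "w \<noteq> x" "simplicial H y" "y \<sim>\<^sub>H x"
    "y \<sim>\<^sub>H z"
    using ex_second_link[OF _ assms(3)] by metis
  have "y \<in> side x x'" using side_closed[OF assms(1,2)] yw(6,7) H_sym by blast
  moreover from this have "w \<in> side x x'"
    using simplicial_side[OF _ yw(5) H_if_G[OF yw(2)] yw(4) assms(1)] by blast
  ultimately show thesis using that yw by blast
qed

lemma o_heavy_pair_G_deg_H:
  assumes "u \<sim>\<^sub>H v" "o_heavy_pair G u v"
  shows "n + 2 \<le> deg H u + deg H v"
proof -
  have "\<not> u \<sim>\<^sub>G v" "\<not> v \<sim>\<^sub>G u" "n \<le> deg G u + deg G v"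
    using assms(2) G_sym by (auto simp: o_heavy_pair_def)
  then show ?thesis
    using deg_strict_mono[OF simple_H edges_subset, of u v]
      deg_strict_mono[OF simple_H edges_subset, of v u] assms(1) H_sym by fastforce
qed

end

context pendant_net
begin

lemma side_adj:
  assumes "v \<in> side a a'"
  shows "a \<sim>\<^sub>H v" "v \<sim>\<^sub>H a" "v \<noteq> a" "v \<in> verts G"
proof -
  show av: "a \<sim>\<^sub>H v" using assms by (auto simp: side_def)
  show "v \<sim>\<^sub>H a" "v \<noteq> a" "v \<in> verts G" using av H_sym H_irrefl H_verts by blast+
qed

lemma side_not_adj:
  assumes "v \<in> side a a'"
  shows "\<not> v \<sim>\<^sub>H b" "\<not> b \<sim>\<^sub>H v" "\<not> v \<sim>\<^sub>H c" "\<not> c \<sim>\<^sub>H v" "v \<noteq> b" "v \<noteq> c" "v \<noteq> b'" "v \<noteq> c'"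
proof -
  have "\<not> v \<sim>\<^sub>H x" if "a \<sim>\<^sub>H x" "\<not> x \<sim>\<^sub>H a'" "x \<noteq> a'" for x
    using side_closed[OF legs_H(1) assms, of x] that H_sym[of a' x] by (auto simp: side_def)
  then show "\<not> v \<sim>\<^sub>H b" "\<not> v \<sim>\<^sub>H c" by simp_all
  then show "\<not> b \<sim>\<^sub>H v" "\<not> c \<sim>\<^sub>H v" using H_sym by blast+
  show "v \<noteq> b" "v \<noteq> c" "v \<noteq> b'" "v \<noteq> c'" using assms by (auto simp: side_def)
qed

lemma side_light:
  assumes "v \<in> side a a'"
  shows "light v b" "light v c"
  using light_if_not_H_adj side_not_adj[OF assms] side_adj[OF assms] by simp_all

lemma side_legs:
  assumes "v \<in> side a a'"
  shows "\<not> v \<sim>\<^sub>H b' \<or> \<not> v \<sim>\<^sub>H c'"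
  using no_independent_nbrs[of v a b' c'] side_adj(2)[OF assms] by auto

lemma corner_nbr_cases:
  assumes "a \<sim>\<^sub>H v"
  obtains "v \<in> side a a'" | "v = b" | "v = c" | "v \<sim>\<^sub>H b" "v \<sim>\<^sub>H c"
proof -
  have "v = a' \<or> v = b \<or> v \<sim>\<^sub>H a' \<or> v \<sim>\<^sub>H b"
    using no_independent_nbrs[of a v a' b] assms by auto
  moreover have "v = c \<or> v \<sim>\<^sub>H c" if "v \<sim>\<^sub>H b"
    using diamond_freeD[OF diamond_free_H, of a b v c] assms that H_sym by auto
  ultimately show thesis using that assms H_sym by (auto simp: side_def)
qed

lemma ex_frontier:
  assumes "two_connected G"
  obtains x w where "x \<in> side a a'" "x \<sim>\<^sub>G w" "w \<noteq> a" "\<not> w \<sim>\<^sub>H a"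
proof -
  have "(adj (induced_subgraph G (verts G - {a})))\<^sup>*\<^sup>* a' b"
    using assms by (simp add: two_connected_def connected_graph_def)
  moreover have "a' \<in> side a a'" "b \<notin> side a a'" by (simp_all add: side_def)
  ultimately obtain x w where
    xw: "adj (induced_subgraph G (verts G - {a})) x w" "x \<in> side a a'" "w \<notin> side a a'"
    by (rule rtranclp_crosses)
  then have "\<not> w \<sim>\<^sub>H a" using side_closed[OF _ xw(2), of w] H_if_G H_sym by auto
  then show thesis using that xw by auto
qed

end

text \<open>
  Two o-heavy partners \<open>y\<close>, \<open>z\<close> of \<open>a\<close>, \<open>b\<close> would close an induced 4-cycle \<open>a y z b\<close> of \<open>H\<close> of
  too large degree sum.
\<close>
lemma (in light_net) light_side_or_light_side: "light_side a a' \<or> light_side b b'"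
proof (rule ccontr)
  assume "\<not> ?thesis"
  then obtain y z where y: "y \<in> side a a'" "o_heavy_pair G a y"
    and z: "z \<in> side b b'" "o_heavy_pair G b z"
    unfolding light_side_def by blast
  note ya = side_adj[OF y(1)] and yb = side_not_adj[OF y(1)]
  note zb = pendant_net.side_adj[OF pendant_net_swap z(1)]
    and za = pendant_net.side_not_adj[OF pendant_net_swap z(1)]
  have heavy: "n + 2 \<le> deg H a + deg H y" "n + 2 \<le> deg H b + deg H z"
    using o_heavy_pair_G_deg_H[OF ya(1) y(2)] o_heavy_pair_G_deg_H[OF zb(1) z(2)] .
  have "y \<noteq> z" using ya za by blast
  then have "y \<sim>\<^sub>H z"
    using no_o_heavy_pair[of y z] heavy light_triangle(1) ya zb
    by (auto simp: o_heavy_pair_def verts_H)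
  then have "deg H a + deg H y + deg H z + deg H b \<le> 2 * n"
    using diamond_free_C4_deg_sum_le[OF simple_H diamond_free_H ya(1) _ zb(2) net_adj(2)
        za(5)[symmetric] yb(5) za(2) yb(1)] verts_H by simp
  then show False using heavy by linarith
qed

locale triangle_net = pendant_net +
  assumes triangle: "a \<sim>\<^sub>G b" "b \<sim>\<^sub>G c" "a \<sim>\<^sub>G c"
begin

lemma triangle_sym: "b \<sim>\<^sub>G a" "c \<sim>\<^sub>G b" "c \<sim>\<^sub>G a"
  using triangle G_sym by blast+

lemma triangle_net_swap: "triangle_net G H b a c b' a' c'"
  and triangle_net_rotate: "triangle_net G H b c a b' c' a'"
  and triangle_net_rotate': "triangle_net G H c a b c' a' b'"
  using pendant_net_swap pendant_net_rotate pendant_net_rotate' triangle triangle_sym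
  by (simp_all add: triangle_net_def triangle_net_axioms_def)

lemma triangle_net_flip: "triangle_net G H a c b a' c' b'"
  by (rule triangle_net.triangle_net_swap[OF triangle_net_rotate'])

end

section \<open>Excluding P5\<close>

context triangle_net
begin

lemma no_P5_through_corner:
  assumes "o_heavy (path_graph 5) G" "z \<sim>\<^sub>G y" "y \<sim>\<^sub>G a" "light z a"
    and "\<not> z \<sim>\<^sub>H b" "\<not> z \<sim>\<^sub>H b'" "\<not> y \<sim>\<^sub>H b" "\<not> y \<sim>\<^sub>H b'"
  shows False
proof -
  have "light z b" "light z b'" "light y b" "light y b'" "light a b'"
    using light_if_not_H_adj assms(5-8) G_verts[OF assms(2)] H_if_G[OF assms(2)]
      H_if_G[OF assms(3)] H_sym
    by (metis net_adj net_not_adj net_neq net_verts)+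
  then have "light_path G [z, y, a, b, b']"
    using assms(2-4) triangle(1) legs(2) by simp
  then show False using length_light_path_less[OF simple_G assms(1)] by fastforce
qed

lemma G_adj_side_if_o_heavy_P5:
  assumes P5: "o_heavy (path_graph 5) G" and "light_side a a'" "z \<in> side a a'"
  shows "a \<sim>\<^sub>G z"
proof (rule ccontr)
  assume "\<not> a \<sim>\<^sub>G z"
  then obtain y w where yw: "a \<sim>\<^sub>G y" "y \<sim>\<^sub>G w" "\<not> a \<sim>\<^sub>G w" "simplicial H y" "y \<in> side a a'"
    "w \<in> side a a'"
    using ex_second_link_in_side[OF legs_H(1) assms(3)] by metis
  note ya = side_adj[OF yw(5)] and ybc = side_not_adj[OF yw(5)] and wbc = side_not_adj[OF yw(6)]
  have "light w a" using light_if_light_side[OF assms(2) legs_H(1) yw(6,3)] light_sym by blast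
  moreover have "\<not> y \<sim>\<^sub>H b'" "\<not> y \<sim>\<^sub>H c'"
    using simplicialD[OF yw(4) ya(2), of b'] simplicialD[OF yw(4) ya(2), of c'] by auto
  moreover have "\<not> w \<sim>\<^sub>H b' \<or> \<not> w \<sim>\<^sub>H c'" by (rule side_legs[OF yw(6)])
  ultimately show False
    using no_P5_through_corner[OF P5, of w y]
      triangle_net.no_P5_through_corner[OF triangle_net_flip P5, of w y]
      yw(1,2) G_sym ybc wbc by blast
qed

lemma side_not_adj_leg_if_o_heavy_P5:
  assumes P5: "o_heavy (path_graph 5) G" and "light_side a a'" and x: "x \<in> side a a'"
  shows "\<not> x \<sim>\<^sub>H b'"
proof
  assume xb': "x \<sim>\<^sub>H b'"
  note xa = side_adj[OF x] and xbc = side_not_adj[OF x]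
  have "a \<sim>\<^sub>G x" by (rule G_adj_side_if_o_heavy_P5[OF assms])
  have xc': "\<not> x \<sim>\<^sub>H c'" using side_legs[OF x] xb' by blast
  obtain y where y: "x \<sim>\<^sub>G y" "y = b' \<or> simplicial H y \<and> y \<sim>\<^sub>H x \<and> y \<sim>\<^sub>H b'"
    using ex_first_link[OF xb'] by blast
  show False
  proof (cases "y = b'")
    case True
    have "light x b" "light x c" "light x c'" "light b' c" "light b' c'" "light b c'"
      using light_if_not_H_adj xa xbc xc' by simp_all
    then have "light_path G [x, b', b, c, c']"
      using y(1) True triangle legs by simp
    then show False using length_light_path_less[OF simple_G P5] by fastforce
  next
    case False
    then have s: "simplicial H y" "y \<sim>\<^sub>H x" "y \<sim>\<^sub>H b'" using y(2) by simp_all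
    have "\<not> y \<sim>\<^sub>H a" "\<not> y \<sim>\<^sub>H c" "\<not> y \<sim>\<^sub>H c'" "y \<noteq> a"
      using simplicialD[OF s(1,3), of a] simplicialD[OF s(1,3), of c]
        simplicialD[OF s(1,3), of c'] s(3)
      by auto
    moreover from this have "light y a" using light_if_not_H_adj H_verts[OF s(3)] by simp
    ultimately show False
      using triangle_net.no_P5_through_corner[OF triangle_net_flip P5, of y x] y(1) G_sym
        \<open>a \<sim>\<^sub>G x\<close> xbc xc'
      by blast
  qed
qed

lemma frontier_adj_leg_if_o_heavy_P5:
  assumes P5: "o_heavy (path_graph 5) G" and "light_side a a'" and x: "x \<in> side a a'"
    and w: "x \<sim>\<^sub>G w" "w \<noteq> a" "\<not> w \<sim>\<^sub>H a"
  shows "w \<sim>\<^sub>H b'"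
proof (rule ccontr)
  assume wb': "\<not> w \<sim>\<^sub>H b'"
  have xb': "\<not> x \<sim>\<^sub>H b'" by (rule side_not_adj_leg_if_o_heavy_P5[OF assms(1-3)])
  have "light w a" using light_if_not_H_adj w G_verts[OF w(1)] by simp
  moreover have "\<not> w \<sim>\<^sub>H b"
  proof
    assume "w \<sim>\<^sub>H b"
    then have "b \<sim>\<^sub>H w" by (rule H_sym)
    then show False
      by (rule pendant_net.corner_nbr_cases[OF pendant_net_swap])
        (use w wb' xb' H_if_G[OF w(1)] H_sym in \<open>auto simp: side_def\<close>)
  qed
  ultimately show False
    using no_P5_through_corner[OF P5, of w x] G_adj_side_if_o_heavy_P5[OF assms(1-3)]
      side_not_adj[OF x]
      w(1) wb' xb' G_sym by blast
qed

lemma not_o_heavy_P5: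
  assumes "two_connected G" "light_side a a'"
  shows "\<not> o_heavy (path_graph 5) G"
proof
  assume P5: "o_heavy (path_graph 5) G"
  obtain x w where xw: "x \<in> side a a'" "x \<sim>\<^sub>G w" "w \<noteq> a" "\<not> w \<sim>\<^sub>H a"
    using ex_frontier[OF assms(1)] by blast
  have "w \<sim>\<^sub>H b'" "w \<sim>\<^sub>H c'"
    using frontier_adj_leg_if_o_heavy_P5[OF P5 assms(2) xw]
      triangle_net.frontier_adj_leg_if_o_heavy_P5[OF triangle_net_flip P5 assms(2) xw] .
  moreover have "\<not> x \<sim>\<^sub>H b'" "\<not> x \<sim>\<^sub>H c'"
    using side_not_adj_leg_if_o_heavy_P5[OF P5 assms(2) xw(1)]
      triangle_net.side_not_adj_leg_if_o_heavy_P5[OF triangle_net_flip P5 assms(2) xw(1)] .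
  ultimately show False
    using no_independent_nbrs[of w x b' c'] side_not_adj[OF xw(1)] H_sym[OF H_if_G[OF xw(2)]]
    by simp
qed

end

section \<open>Excluding Z2\<close>

context triangle_net
begin

lemma no_Z2_through_corner:
  assumes "o_heavy (Z_graph 2) G" "a \<sim>\<^sub>G y" "y \<sim>\<^sub>G z" "light a z"
    and "\<not> y \<sim>\<^sub>H b" "\<not> y \<sim>\<^sub>H c" "light z b" "light z c"
  shows False
proof -
  have "y \<noteq> b" "y \<noteq> c" "y \<in> verts G" using assms(5,6) G_verts[OF assms(2)] by auto
  then have "light b y" "light c y"
    using light_if_not_H_adj[of y] assms(5,6) light_sym by simp_all
  moreover have "light_path G [a, y, z]" using assms(2-4) G_verts[OF assms(3)] by simp
  ultimately show False
    using length_light_tail_less[OF simple_G assms(1) _ triangle(2) triangle_sym(1,3), of "[y, z]"]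
      assms(7,8) light_sym by fastforce
qed

lemma no_Z2_in_side:
  assumes "o_heavy (Z_graph 2) G" "y \<in> side a a'" "z \<in> side a a'" "a \<sim>\<^sub>G y" "a \<sim>\<^sub>G z" "y \<sim>\<^sub>G z"
    and "\<not> y \<sim>\<^sub>H b'" "\<not> z \<sim>\<^sub>H b'"
  shows False
proof -
  have "light y b'" "light z b'" "light a b'"
    using light_if_not_H_adj side_adj side_not_adj assms(2,3,7,8) by simp_all
  moreover have "light_path G [a, b, b']" using triangle(1) legs(2) \<open>light a b'\<close> by simp
  ultimately show False
    using length_light_tail_less[OF simple_G assms(1) _ assms(6) assms(4,5)[THEN G_sym],
        of "[b, b']"]
      side_light(1) assms(2,3) by fastforce
qed

lemma G_adj_side_if_o_heavy_Z2:
  assumes Z2: "o_heavy (Z_graph 2) G" and "light_side a a'" "z \<in> side a a'"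
  shows "a \<sim>\<^sub>G z"
proof (rule ccontr)
  assume "\<not> a \<sim>\<^sub>G z"
  then obtain y w where yw: "a \<sim>\<^sub>G y" "y \<sim>\<^sub>G w" "\<not> a \<sim>\<^sub>G w" "y \<in> side a a'" "w \<in> side a a'"
    using ex_second_link_in_side[OF legs_H(1) assms(3)] by metis
  show False
    using no_Z2_through_corner[OF Z2 yw(1,2)] light_if_light_side[OF assms(2) legs_H(1) yw(5,3)]
      side_not_adj[OF yw(4)] side_light[OF yw(5)] by blast
qed

lemma side_eq_singleton_if_o_heavy_Z2:
  assumes Z2: "o_heavy (Z_graph 2) G" and "light_side a a'"
  shows "side a a' = {a'}"
proof (rule ccontr)
  assume "side a a' \<noteq> {a'}"
  moreover have "a' \<in> side a a'" by (simp add: side_def)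
  ultimately obtain z where z: "z \<in> side a a'" "z \<noteq> a'" by blast
  then have "z \<sim>\<^sub>H a'" using H_sym by (auto simp: side_def)
  then obtain y where y: "z \<sim>\<^sub>G y" "y = a' \<or> simplicial H y \<and> y \<sim>\<^sub>H z \<and> y \<sim>\<^sub>H a'"
    by (rule ex_first_link)
  have y_legs: "\<not> y \<sim>\<^sub>H b'" "\<not> y \<sim>\<^sub>H c'" "y \<noteq> a"
    using y(2) simplicialD[of H y a' b'] simplicialD[of H y a' c'] simplicialD[of H a a' b]
    by auto
  have "y \<in> side a a'"
  proof (cases "y = a'")
    case False
    then have "a' \<sim>\<^sub>H y" "z \<sim>\<^sub>H y" using y H_if_G H_sym by blast+
    then have "a \<sim>\<^sub>H y"
      using diamond_freeD[OF diamond_free_H, of a' z a y] \<open>z \<sim>\<^sub>H a'\<close> side_adj[OF z(1)] y_legs(3)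
        H_sym by auto
    then show ?thesis using \<open>a' \<sim>\<^sub>H y\<close> by (simp add: side_def)
  qed (simp add: side_def)
  moreover from this have "a \<sim>\<^sub>G z" "a \<sim>\<^sub>G y"
    using G_adj_side_if_o_heavy_Z2[OF assms] z(1) by blast+
  ultimately show False
    using no_Z2_in_side[OF Z2 z(1), of y]
      triangle_net.no_Z2_in_side[OF triangle_net_flip Z2 z(1), of y]
      side_legs[OF z(1)] y(1) y_legs by blast
qed

lemma return_G_nbr:
  assumes Z2: "o_heavy (Z_graph 2) G" and "side a a' = {a'}" "side b b' = {b'}"
    and w: "a' \<sim>\<^sub>G w" "w \<noteq> a"
  shows "w \<in> side c c'" "\<not> light c w"
proof -
  note a'w = H_if_G[OF w(1)] H_sym[OF H_if_G[OF w(1)]]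
  have wa: "\<not> w \<sim>\<^sub>H a"
    using assms(2) a'w H_irrefl H_sym[of w a] by (auto simp: side_def)
  have wne: "w \<noteq> b" "w \<noteq> c" "w \<noteq> b'" using a'w by auto
  have "\<not> w \<sim>\<^sub>H b"
  proof
    assume "w \<sim>\<^sub>H b"
    then have "b \<sim>\<^sub>H w" by (rule H_sym)
    then show False
      by (rule pendant_net.corner_nbr_cases[OF pendant_net_swap])
        (use assms(3) wne wa w(2) in auto)
  qed
  then have "light w b" "light w a"
    using light_if_not_H_adj[of w] wa wne w(2) H_verts[OF a'w(1)] by auto
  then show "\<not> light c w"
    using no_Z2_through_corner[OF Z2 legs(1) w(1)] light_sym by auto
  then have "c \<sim>\<^sub>H w"
    using light_if_not_H_adj[of c w] wne H_verts[OF a'w(1)] by auto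
  then show "w \<in> side c c'"
    by (rule pendant_net.corner_nbr_cases[OF pendant_net_rotate']) (use wa wne w(2) in auto)
qed

lemma ex_return_vertex:
  assumes Z2: "o_heavy (Z_graph 2) G" and sides: "side a a' = {a'}" "side b b' = {b'}"
    and "two_connected G"
  obtains r where "a' \<sim>\<^sub>G r" "r \<in> side c c'" "\<not> light c r" "nbhd H a' = {a, r}"
proof -
  note return = return_G_nbr[OF Z2 sides]
  note c_side = pendant_net.side_adj[OF pendant_net_rotate']
  obtain x r where "x \<in> side a a'" "x \<sim>\<^sub>G r" "r \<noteq> a"
    by (rule ex_frontier[OF assms(4)])
  then have r: "a' \<sim>\<^sub>G r" "r \<noteq> a" using sides(1) by simp_all
  have "v = r" if v: "a' \<sim>\<^sub>H v" "v \<noteq> a" for v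
  proof (rule ccontr)
    assume "v \<noteq> r"
    obtain y where y: "a' \<sim>\<^sub>G y" "y = v \<or> simplicial H y \<and> y \<sim>\<^sub>H a' \<and> y \<sim>\<^sub>H v"
      using v(1) by (rule ex_first_link)
    have "y \<noteq> a"
      using y(2) v simplicialD[of H a a' b] by auto
    then have "y = v"
      using y(2) simplicialD[of H y a' c] c_side(2)[OF return(1)[OF y(1)]] by auto
    then have "v \<in> side c c'" using return(1) y(1) v(2) by blast
    then have "r \<sim>\<^sub>H v" "r \<sim>\<^sub>H c" "v \<sim>\<^sub>H c"
      using side_clique[of c c' r v] return(1)[OF r] c_side(2) \<open>v \<noteq> r\<close> by auto
    then show False
      using diamond_freeD[OF diamond_free_H, of r v a' c] H_if_G[OF r(1)] v(1) H_sym by auto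
  qed
  then have "nbhd H a' = {a, r}" using H_if_G[OF r(1)] by auto
  then show thesis using that r(1) return[OF r] by blast
qed

end

text \<open>
  The configuration left over by the exclusion of Z2: two of the three sides are single edges
  that return, through one further edge each, to the third side.
\<close>
locale theta_net = triangle_net +
  fixes r s :: 'a
  assumes Z2: "o_heavy (Z_graph 2) G"
    and return_r: "a' \<sim>\<^sub>G r" "r \<in> side c c'" "\<not> light c r" "nbhd H a' = {a, r}"
    and return_s: "b' \<sim>\<^sub>G s" "s \<in> side c c'" "\<not> light c s" "nbhd H b' = {b, s}"
begin

lemma theta_net_swap: "theta_net G H b a c b' a' c' s r"
  using triangle_net_swap Z2 return_r return_s by (simp add: theta_net_def theta_net_axioms_def)

abbreviation side_nbrs :: "'a \<Rightarrow> 'a set" where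
  "side_nbrs x \<equiv> side c c' \<inter> nbhd G x"

lemma finite_side_nbrs [simp]: "finite (side_nbrs x)"
  using finite_nbhd[OF simple_G] by simp

lemma side_c:
  assumes "u \<in> side c c'"
  shows "\<not> u \<sim>\<^sub>H a" "\<not> u \<sim>\<^sub>H b" "u \<noteq> a" "u \<noteq> b" "u \<noteq> a'" "u \<noteq> b'" "u \<noteq> c" "u \<in> verts G" "c \<sim>\<^sub>H u"
    "u \<sim>\<^sub>H a' \<Longrightarrow> u = r" "u \<sim>\<^sub>H b' \<Longrightarrow> u = s"
proof -
  note facts = pendant_net.side_not_adj[OF pendant_net_rotate' assms]
    pendant_net.side_adj[OF pendant_net_rotate' assms]
  show "\<not> u \<sim>\<^sub>H a" "\<not> u \<sim>\<^sub>H b" "u \<noteq> a" "u \<noteq> b" "u \<noteq> a'" "u \<noteq> b'" "u \<noteq> c" "u \<in> verts G" "c \<sim>\<^sub>H u"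
    using facts by simp_all
  show "u = r" if "u \<sim>\<^sub>H a'" using return_r(4) H_sym[OF that] \<open>u \<noteq> a\<close> by (auto simp: set_eq_iff)
  show "u = s" if "u \<sim>\<^sub>H b'" using return_s(4) H_sym[OF that] \<open>u \<noteq> b\<close> by (auto simp: set_eq_iff)
qed

lemma corners_not_in_side [simp]: "a \<notin> side c c'" "b \<notin> side c c'" "c \<notin> side c c'" "a' \<notin> side c c'"
  using side_c(3-5,7) by blast+

lemma return_H_adj: "a' \<sim>\<^sub>H r" "r \<sim>\<^sub>H a'" "b' \<sim>\<^sub>H s" "s \<sim>\<^sub>H b'"
  using H_if_G[OF return_r(1)] H_if_G[OF return_s(1)] H_sym by blast+

lemma r_neq_s: "r \<noteq> s"
proof
  assume "r = s"
  then show False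
    using no_independent_nbrs[of r a' b' c] return_H_adj H_sym[OF side_c(9)[OF return_r(2)]]
    by simp
qed

lemma nbhd_return: "nbhd G r \<subseteq> {a', c} \<union> side_nbrs r"
proof
  fix v assume "v \<in> nbhd G r"
  then have rv: "r \<sim>\<^sub>G v" "r \<sim>\<^sub>H v" using H_if_G by simp_all
  have "v = a' \<or> v = c \<or> v \<sim>\<^sub>H a' \<or> v \<sim>\<^sub>H c"
    using no_independent_nbrs[of r v a' c] rv return_H_adj H_sym[OF side_c(9)[OF return_r(2)]]
    by auto
  moreover have "\<not> v \<sim>\<^sub>H a'"
  proof
    assume "v \<sim>\<^sub>H a'"
    then have "v \<in> {a, r}" using return_r(4) H_sym by auto
    then show False using rv(2) side_c(1)[OF return_r(2)] H_irrefl by auto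
  qed
  moreover have "v \<in> side c c'" if "v \<sim>\<^sub>H c"
    using side_closed[OF legs_H(3) return_r(2) rv(2)] H_sym[OF that] by blast
  ultimately show "v \<in> {a', c} \<union> side_nbrs r" using rv(1) by auto
qed

lemma corner_side_nbrs_adj:
  assumes "u \<in> side_nbrs c" "v \<in> side_nbrs c" "u \<sim>\<^sub>G v"
  shows "{u, v} = {r, s}"
proof (rule ccontr)
  have uv: "u \<in> side c c'" "v \<in> side c c'" "c \<sim>\<^sub>G u" "c \<sim>\<^sub>G v" "u \<noteq> v"
    using assms G_irrefl by auto
  assume "{u, v} \<noteq> {r, s}"
  then consider "u \<noteq> r" "v \<noteq> r" | "u \<noteq> s" "v \<noteq> s" using r_neq_s uv(5) by blast
  then show False
  proof cases
    case 1
    then show False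
      using triangle_net.no_Z2_in_side[OF triangle_net_rotate' Z2 uv(1-4) assms(3)] side_c(10)
        uv(1,2) by blast
  next
    case 2
    then show False
      using triangle_net.no_Z2_in_side[OF triangle_net.triangle_net_flip[OF triangle_net_rotate']
          Z2 uv(1-4) assms(3)]
        side_c(11) uv(1,2) by blast
  qed
qed

lemma return_side_nbrs_not_adj:
  assumes "u \<in> side_nbrs r" "v \<in> side_nbrs r"
  shows "\<not> u \<sim>\<^sub>G v"
proof
  assume "u \<sim>\<^sub>G v"
  have uv: "u \<in> side c c'" "v \<in> side c c'" "r \<sim>\<^sub>G u" "r \<sim>\<^sub>G v" "u \<noteq> r" "v \<noteq> r"
    using assms G_irrefl by auto
  have "light x a'" "light x a" if "x \<in> {u, v}" for x
    using light_if_not_H_adj[of x a'] light_if_not_H_adj[of x a] side_c[of x] uv that by auto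
  moreover have "light_path G [r, a', a]"
    using return_r(1) G_sym light_if_not_H_adj[of r a] side_c[OF return_r(2)] by simp
  ultimately show False
    using length_light_tail_less[OF simple_G Z2 _ \<open>u \<sim>\<^sub>G v\<close> uv(3,4)[THEN G_sym], of "[a', a]"]
    by fastforce
qed

lemma corner_side_nbrs_heavy:
  assumes "u \<in> side_nbrs c" "v \<in> side_nbrs c" "u \<noteq> v" "\<not> u \<sim>\<^sub>G v"
  shows "n \<le> deg G u + deg G v"
proof (rule ccontr)
  assume "\<not> ?thesis"
  then have "light u v" using assms side_c(8) by (auto simp: light_pair_def o_heavy_pair_def)
  moreover have "light u a" "light v a"
    using light_if_not_H_adj side_c assms(1,2) by auto
  ultimately show False using no_light_claw[of c u v a] assms triangle_sym(3) by auto
qed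

lemma return_side_nbrs_heavy:
  assumes "u \<in> side_nbrs r" "v \<in> side_nbrs r" "u \<noteq> v"
  shows "n \<le> deg G u + deg G v"
proof (rule ccontr)
  assume "\<not> ?thesis"
  then have "light u v"
    using assms side_c(8) return_side_nbrs_not_adj[OF assms(1,2)]
    by (auto simp: light_pair_def o_heavy_pair_def)
  moreover have "light x a'" if "x \<in> side_nbrs r" for x
    using light_if_not_H_adj[of x a'] side_c[of x] that G_irrefl by auto
  ultimately show False using no_light_claw[of r u v a'] assms return_r(1) G_sym by auto
qed

lemma leg_not_return: "c' \<noteq> r" "c' \<noteq> s"
  using return_H_adj net_not_adj by metis+

lemma eight_le_n: "8 \<le> n"
proof -
  have "card {a, b, c, a', b', c', r, s} = 8"
    using r_neq_s leg_not_return side_c[OF return_r(2)] side_c[OF return_s(2)] by simp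
  moreover have "{a, b, c, a', b', c', r, s} \<subseteq> verts G"
    using side_c(8)[OF return_r(2)] side_c(8)[OF return_s(2)] by simp
  ultimately show ?thesis using card_mono[OF finite_verts[OF simple_G]] by metis
qed

lemma deg_return_less: "2 * deg G r < n"
proof -
  have "deg G r \<le> card ({a', c} \<union> side_nbrs r)"
    unfolding deg_def by (rule card_mono[OF _ nbhd_return]) simp
  also have "\<dots> \<le> 2 + card (side_nbrs r)"
    using card_Un_le[of "{a', c}" "side_nbrs r"] by simp
  finally have deg: "deg G r \<le> 2 + card (side_nbrs r)" .
  show ?thesis
  proof (cases "card (side_nbrs r) \<le> 1")
    case True
    then show ?thesis using deg eight_le_n by simp
  next
    case False
    then obtain u v where uv: "u \<in> side_nbrs r" "v \<in> side_nbrs r" "u \<noteq> v"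
      by (metis One_nat_def card_le_Suc0_iff_eq finite_side_nbrs)
    have "2 * card (side_nbrs r \<union> {a, b, a'}) \<le> n"
    proof (rule card_common_non_nbrs_le_half[OF simple_G return_side_nbrs_heavy[OF uv]])
      show "side_nbrs r \<union> {a, b, a'} \<subseteq> verts G" using side_c(8) by auto
      have "\<not> x \<sim>\<^sub>G w" if "x \<in> side_nbrs r" "w \<in> side_nbrs r \<union> {a, b, a'}" for x w
        using return_side_nbrs_not_adj[of x w] side_c[of x] that H_if_G G_irrefl by auto
      then show "\<not> u \<sim>\<^sub>G w \<and> \<not> v \<sim>\<^sub>G w" if "w \<in> side_nbrs r \<union> {a, b, a'}" for w
        using uv that by blast
    qed
    moreover have "card (side_nbrs r \<union> {a, b, a'}) = card (side_nbrs r) + card {a, b, a'}"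
      by (intro card_Un_disjoint) auto
    ultimately show ?thesis using deg by simp
  qed
qed

lemma leg_mem_corner_side_nbrs: "c' \<in> side_nbrs c"
  using legs(3) by (simp add: side_def)

lemma corner_adj_return: "c \<sim>\<^sub>G r"
proof (rule ccontr)
  assume not_adj: "\<not> c \<sim>\<^sub>G r"
  then have heavy: "n \<le> deg G c + deg G r"
    using return_r(3) side_c[OF return_r(2)] by (auto simp: light_pair_def o_heavy_pair_def)
  have no_edge: "\<not> u \<sim>\<^sub>G v" if "u \<in> side_nbrs c" "v \<in> side_nbrs c" for u v
    using corner_side_nbrs_adj[OF that] that not_adj by auto
  show False
  proof (cases "side_nbrs c = {c'}")
    case True
    have "card {c, r} \<le> card (nbhd G c \<inter> nbhd G r)"
      using not_adj G_sym[of r c] G_irrefl side_c(8)[OF return_r(2)]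
      by (intro card_common_non_nbrs_le[OF simple_G heavy]) auto
    also have "nbhd G c \<inter> nbhd G r \<subseteq> side_nbrs c"
      using nbhd_return H_if_G[of c a'] G_irrefl by auto
    then have "card (nbhd G c \<inter> nbhd G r) \<le> card {c'}"
      unfolding True by (rule card_mono[rotated]) simp
    finally show False using side_c(7)[OF return_r(2)] by simp
  next
    case False
    then obtain v where v: "v \<in> side_nbrs c" "v \<noteq> c'" using leg_mem_corner_side_nbrs by blast
    have separated: "\<not> x \<sim>\<^sub>G w" if x: "x \<in> side_nbrs c" and w: "w \<in> nbhd G c" for x w
    proof
      assume "x \<sim>\<^sub>G w"
      then have "w \<in> side_nbrs c"
        using side_closed[OF legs_H(3), of x w] x w H_if_G by auto
      then show False using no_edge[OF x] \<open>x \<sim>\<^sub>G w\<close> by blast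
    qed
    have "n \<le> deg G v + deg G c'"
      using corner_side_nbrs_heavy v leg_mem_corner_side_nbrs no_edge by blast
    then have "2 * card (nbhd G c) \<le> n"
      by (rule card_common_non_nbrs_le_half[OF simple_G _ nbhd_subset_verts[OF simple_G]])
        (use separated v(1) leg_mem_corner_side_nbrs in blast)
    then show False using heavy deg_return_less by (simp add: deg_def)
  qed
qed

lemma returns_adj: "r \<sim>\<^sub>G s"
proof (rule ccontr)
  assume "\<not> r \<sim>\<^sub>G s"
  moreover have "r \<in> side_nbrs c" "s \<in> side_nbrs c"
    using corner_adj_return theta_net.corner_adj_return[OF theta_net_swap] return_r(2) return_s(2)
    by simp_all
  ultimately have "n \<le> deg G r + deg G s"
    using corner_side_nbrs_heavy r_neq_s by blast
  then show False
    using deg_return_less theta_net.deg_return_less[OF theta_net_swap] by linarith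
qed

lemma ex_third_return_side_nbr: "\<exists>u. u \<in> side_nbrs r - {s}"
proof -
  have rA: "r \<in> side_nbrs c" and sA: "s \<in> side_nbrs c"
    using corner_adj_return theta_net.corner_adj_return[OF theta_net_swap] return_r(2) return_s(2)
    by simp_all
  have not_adj: "\<not> c' \<sim>\<^sub>G r" "\<not> c' \<sim>\<^sub>G s"
    using corner_side_nbrs_adj[OF leg_mem_corner_side_nbrs] rA sA leg_not_return by blast+
  have "card {c', r} \<le> card (nbhd G c' \<inter> nbhd G r)"
    using not_adj(1) G_sym[of r c'] G_irrefl side_c(8)[OF return_r(2)]
    by (intro card_common_non_nbrs_le[OF simple_G
          corner_side_nbrs_heavy[OF leg_mem_corner_side_nbrs rA leg_not_return(1) not_adj(1)]]) auto
  also have "nbhd G c' \<inter> nbhd G r \<subseteq> insert c (side_nbrs r - {s})"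
    using nbhd_return not_adj(2) H_if_G[of c' a'] by auto
  then have "card (nbhd G c' \<inter> nbhd G r) \<le> card (insert c (side_nbrs r - {s}))"
    by (rule card_mono[rotated]) simp
  finally have "side_nbrs r - {s} \<noteq> {}" using leg_not_return(1) by force
  then show ?thesis by blast
qed

lemma card_return_side_nbrs_less: "card (side_nbrs r) < card (side_nbrs s)"
proof -
  obtain u where u: "u \<in> side_nbrs r" "u \<noteq> s" using ex_third_return_side_nbr by blast
  have sB: "s \<in> side_nbrs r" using returns_adj return_s(2) by simp
  have "card (side_nbrs r \<union> {a, b}) \<le> card (nbhd G u \<inter> nbhd G s)"
  proof (rule card_common_non_nbrs_le[OF simple_G return_side_nbrs_heavy[OF u(1) sB u(2)]])
    show "side_nbrs r \<union> {a, b} \<subseteq> verts G" using side_c(8) by auto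
    show "\<not> u \<sim>\<^sub>G w \<and> \<not> s \<sim>\<^sub>G w" if "w \<in> side_nbrs r \<union> {a, b}" for w
      using that return_side_nbrs_not_adj[of u w] return_side_nbrs_not_adj[of s w] u sB
        side_c[of u] side_c[of s] H_if_G by auto
  qed
  moreover have "card (side_nbrs r \<union> {a, b}) = card (side_nbrs r) + card {a, b}"
    by (intro card_Un_disjoint) auto
  moreover have "nbhd G u \<inter> nbhd G s \<subseteq> insert c (side_nbrs s)"
    using theta_net.nbhd_return[OF theta_net_swap] side_c(11)[of u] u H_if_G by auto
  then have "card (nbhd G u \<inter> nbhd G s) \<le> card (insert c (side_nbrs s))"
    by (rule card_mono[rotated]) simp
  moreover have "card (insert c (side_nbrs s)) \<le> Suc (card (side_nbrs s))"
    by (simp add: card_insert_if)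
  ultimately show ?thesis by simp
qed

end

lemma (in triangle_net) not_o_heavy_Z2:
  assumes "two_connected G" "light_side a a'" "light_side b b'"
  shows "\<not> o_heavy (Z_graph 2) G"
proof
  assume Z2: "o_heavy (Z_graph 2) G"
  note sides = side_eq_singleton_if_o_heavy_Z2[OF Z2 assms(2)]
    triangle_net.side_eq_singleton_if_o_heavy_Z2[OF triangle_net_swap Z2 assms(3)]
  obtain r where r: "a' \<sim>\<^sub>G r" "r \<in> side c c'" "\<not> light c r" "nbhd H a' = {a, r}"
    by (rule ex_return_vertex[OF Z2 sides assms(1)])
  obtain s where s: "b' \<sim>\<^sub>G s" "s \<in> side c c'" "\<not> light c s" "nbhd H b' = {b, s}"
    by (rule triangle_net.ex_return_vertex[OF triangle_net_swap Z2 sides(2,1) assms(1)])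
  interpret theta_net G H a b c a' b' c' r s
    by unfold_locales (fact Z2 r s)+
  show False
    using card_return_side_nbrs_less theta_net.card_return_side_nbrs_less[OF theta_net_swap]
    by simp
qed

section \<open>The triangles of nets are a-heavy\<close>

lemma (in light_net) triangle_net_if_o_heavy:
  assumes "o_heavy (path_graph 5) G \<or> o_heavy (Z_graph 2) G"
  shows "triangle_net G H a b c a' b' c'"
proof -
  note rotate = light_net_rotate light_net.light_net_rotate[OF light_net_rotate]
  have "a \<sim>\<^sub>G b" "b \<sim>\<^sub>G c" "c \<sim>\<^sub>G a"
    using assms adj_if_o_heavy_P5 rotate[THEN light_net.adj_if_o_heavy_P5]
      adj_if_o_heavy_Z2 rotate[THEN light_net.adj_if_o_heavy_Z2] by blast+
  then show ?thesis by unfold_locales (auto intro: G_sym)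
qed

lemma (in light_net) not_o_heavy:
  assumes "two_connected G"
  shows "\<not> o_heavy net G" "\<not> o_heavy (path_graph 5) G" "\<not> o_heavy (Z_graph 2) G"
proof -
  note rotate = light_net_rotate light_net.light_net_rotate[OF light_net_rotate]
  note light_sides = light_side_or_light_side rotate[THEN light_net.light_side_or_light_side]
  show "\<not> o_heavy net G" by (rule not_o_heavy_net)
  show "\<not> o_heavy (path_graph 5) G"
  proof
    assume P5: "o_heavy (path_graph 5) G"
    then interpret triangle_net G H a b c a' b' c' using triangle_net_if_o_heavy by blast
    show False
      using P5 light_sides(1) not_o_heavy_P5[OF assms]
        triangle_net.not_o_heavy_P5[OF triangle_net_swap assms] by blast
  qed
  show "\<not> o_heavy (Z_graph 2) G"
  proof
    assume Z2: "o_heavy (Z_graph 2) G"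
    then interpret triangle_net G H a b c a' b' c' using triangle_net_if_o_heavy by blast
    show False
      using Z2 light_sides not_o_heavy_Z2[OF assms]
        triangle_net.not_o_heavy_Z2[OF triangle_net_rotate assms]
        triangle_net.not_o_heavy_Z2[OF triangle_net_rotate' assms] by blast
  qed
qed

context claw_heavy_closure
begin

lemma ex_light_net:
  assumes "induced_net H a b c a' b' c'" "deg H a + deg H b < n" "deg H b + deg H c < n"
    "deg H a + deg H c < n"
  obtains a' b' c' where "light_net G H a b c a' b' c'"
proof -
  obtain a'' where a'': "a \<sim>\<^sub>G a''" "induced_net H a b c a'' b' c'"
    by (rule induced_net_replace_leg[OF assms(1)])
  obtain b'' where b'': "b \<sim>\<^sub>G b''" "induced_net H b c a b'' c' a''"
    by (rule induced_net_replace_leg[OF induced_net_rotate[OF a''(2)]])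
  obtain c'' where c'': "c \<sim>\<^sub>G c''" "induced_net H c a b c'' a'' b''"
    by (rule induced_net_replace_leg[OF induced_net_rotate[OF b''(2)]])
  have "light_net G H a b c a'' b'' c''"
    by unfold_locales (fact a''(1) b''(1) c''(1) induced_net_rotate[OF c''(2)] assms(2-4))+
  then show thesis by (rule that)
qed

lemma N_p_heavy_H:
  assumes "two_connected G"
    and "o_heavy net G \<or> o_heavy (path_graph 5) G \<or> o_heavy (Z_graph 2) G"
  shows "N_p_heavy H"
  unfolding N_p_heavy_def
proof (intro allI impI, rule ccontr)
  fix A f
  assume A: "A \<subseteq> verts H" and iso: "graph_iso f net (induced_subgraph H A)"
    and no_heavy: "\<not> (\<exists>i\<in>{0, 1, 2}. \<exists>j\<in>{0, 1, 2}. a_heavy_pair H (f i) (f j))"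
  have net: "induced_net H (f 0) (f 1) (f 2) (f 3) (f 4) (f 5)"
    using iso induced_net_if_embedding unfolding graph_iso_induced_subgraph_iff[OF A] by blast
  then have "f 0 \<sim>\<^sub>H f 1" "f 1 \<sim>\<^sub>H f 2" "f 0 \<sim>\<^sub>H f 2" by (simp_all add: induced_net_def)
  then have "deg H (f 0) + deg H (f 1) < n" "deg H (f 1) + deg H (f 2) < n"
    "deg H (f 0) + deg H (f 2) < n"
    using no_heavy by (auto simp: a_heavy_pair_def verts_H)
  from ex_light_net[OF net this] obtain a' b' c'
    where "light_net G H (f 0) (f 1) (f 2) a' b' c'" .
  from light_net.not_o_heavy[OF this assms(1)] show False using assms(2) by blast
qed

end

theorem theorem11:
  fixes G clG :: "'a ugraph" and S :: "nat ugraph"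
  assumes "simple_graph G"
    and "two_connected G"
    and "S \<in> {path_graph 4, path_graph 5, cycle_graph 3, Z_graph 1, Z_graph 2, bull, net}"
    and "family_o_heavy {claw, S} G"
    and "is_cl_c G clG"
  shows "claw_free clG \<and> N_p_heavy clG"
proof -
  have heavy: "o_heavy claw G" "o_heavy S G"
    using assms(4) by (simp_all add: family_o_heavy_def)
  interpret claw_heavy_closure G clG
    by unfold_locales (fact assms(1) heavy(1) assms(5))+
  have "o_heavy net G \<or> o_heavy (path_graph 5) G \<or> o_heavy (Z_graph 2) G"
    using assms(3) heavy(2) o_heavy_net_if_induced_subgraph by blast
  then show ?thesis using claw_free_H N_p_heavy_H[OF assms(2)] by blast
qed

end
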